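(* Let $\nu\geq 2$ be an integer, let $\mathbf{c}=(c_\nu,c_{\nu-1},\ldots,c_1)\in\mathbb{Z}^{\nu}$ be a fixed non-zero vector, and let $P(x)=c_{\nu}x^{\nu}+c_{\nu-1}x^{\nu-1}+\cdots+c_1x$ have non-zero discriminant. Let $J$ be the number of distinct irreducible factors of $P(x)$ in $\mathbb{Z}[x]$. Then for all $Q\geq 1$, \[\frac{1}{Q}\ll D_{\mathcal{N}_{Q,P}}(\mathcal{F}_{Q,P})\ll\frac{(\log Q)^J}{Q},\] where the implied constants depend on $P$.
   Context: For a positive integer $Q$, $\mathcal{F}_{Q,P}=\{a/q: 1\leq a\leq q\leq Q,\ \gcd(P(a),q)=1\}\subset(0,1]$ (polynomial Farey fractions), and $\mathcal{N}_{Q,P}=\#\mathcal{F}_{Q,P}$. For a finite set of $N$ points $x_1,\dots,x_N$ in $[0,1]$, for $\alpha\in[0,1]$ let $A(\alpha;N)$ be the number of points not exceeding $\alpha$, $R_N(\alpha)=|A(\alpha;N)/N-\alpha|$, and the discrepancy is $D_N=\sup_{0\le\alpha\le1}R_N(\alpha)$; $D_{\mathcal{N}_{Q,P}}(\mathcal{F}_{Q,P})$ is the discrepancy of the points of $\mathcal{F}_{Q,P}$.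
   Formalization: The upper bound is stated for Q ≥ 2 only, since at Q = 1 the discrepancy is 1 while (log 1)^J/1 = 0 (J ≥ 1 because x divides P); J counts irreducible factors of positive degree up to sign, which gives a bound at least as strong. *)

theory Defs
  imports
    Complex_Main
    "HOL-Computational_Algebra.Polynomial_Factorial"
    "Subresultants.Resultant_Prelim"
begin

definition poly_farey :: "int poly \<Rightarrow> nat \<Rightarrow> real set" where
  "poly_farey P Q =
     {real a / real q | a q. 1 \<le> a \<and> a \<le> q \<and> q \<le> Q \<and> gcd (poly P (int a)) (int q) = 1}"

definition discrepancy :: "real set \<Rightarrow> real" where
  "discrepancy S =
     (SUP \<alpha>\<in>{0..1}. \<bar>real (card {x \<in> S. x \<le> \<alpha>}) / real (card S) - \<alpha>\<bar>)"

text \<open>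
  The classical formula \<open>(-1)\<^bsup>n(n-1)/2\<^esup> Res(f, f') / a\<^sub>n\<close> with \<open>n = deg f\<close> and \<open>a\<^sub>n\<close> the leading
  coefficient. For \<open>n \<ge> 1\<close> the division is exact: the first column of the Sylvester matrix of
  \<open>f\<close> and \<open>f'\<close> has no non-zero entries besides \<open>a\<^sub>n\<close> and \<open>n a\<^sub>n\<close>.
\<close>

definition discriminant :: "int poly \<Rightarrow> int" where
  "discriminant f =
     (-1) ^ (degree f * (degree f - 1) div 2) * resultant f (pderiv f) div lead_coeff f"

text \<open>
  Irreducible factors of positive degree, counted up to the units \<open>\<plusminus>1\<close> of \<open>\<int>[x]\<close> (a normalized
  integer polynomial is one with positive leading coefficient). Prime numbers dividing the
  content of \<open>f\<close> are not counted.
\<close>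

definition num_irreducible_factors :: "int poly \<Rightarrow> nat" where
  "num_irreducible_factors f =
     card {g. irreducible g \<and> 0 < degree g \<and> normalize g = g \<and> g dvd f}"

end

theory Submission
  imports Defs "HOL-Computational_Algebra.Squarefree" "HOL-Library.FuncSet"
begin

text \<open>
  Every point of the set is at least \<open>1/Q\<close>, which gives the lower bound. Since \<open>x\<close> divides \<open>P\<close>, the
  fractions are in lowest terms, so the counting function is a sum over \<open>q \<le> Q\<close>; inclusion-exclusion
  bounds its deviation by \<open>Q\<close> times the sum of \<open>\<rho>\<^sub>P(d)/d\<close> over squarefree \<open>d \<le> Q\<close>, where \<open>\<rho>\<^sub>P(d)\<close> is
  the number of roots of \<open>P\<close> modulo \<open>d\<close>. This sum is submultiplicative in \<open>P\<close> and depends only on the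
  distinct irreducible factors of \<open>P\<close>. A constant factor contributes \<open>O(1)\<close>, and an irreducible \<open>g\<close> of
  positive degree contributes \<open>O(log Q)\<close>, because the squarefree \<open>d \<le> x\<close> satisfy \<open>\<Sum> \<rho>\<^sub>g(d) = O(x)\<close>: a root of
  \<open>g\<close> modulo \<open>d\<close> defines a lattice of index \<open>d\<close> in the polynomials of degree below \<open>n = deg g\<close>, which
  contains a nonzero polynomial with coefficients of size \<open>d\<^bsup>1/n\<^esup>\<close>, and such a polynomial arises from a
  bounded number of roots since its resultant with \<open>g\<close> is a bounded multiple of \<open>d\<close>. Finally, the set
  has at least \<open>c Q\<^sup>2\<close> elements, by sieving the denominators in a progression \<open>1 mod M\<close> where \<open>M\<close> is
  divisible by all small primes.
\<close>

section \<open>Determinants of polynomial coefficients\<close>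

definition coeff_mat :: "nat \<Rightarrow> (nat \<Rightarrow> int poly) \<Rightarrow> int mat" where
  "coeff_mat N f = mat N N (\<lambda>(i, j). coeff (f i) j)"

lemma coeff_mat_carrier [simp]: "coeff_mat N f \<in> carrier_mat N N"
  by (simp add: coeff_mat_def)

text \<open>In the Leibniz formula every permutation picks exactly one entry from each column, so
  each term collects all the factors \<open>D j\<close>.\<close>

lemma prod_column_divisors_dvd_det:
  fixes B :: "int mat"
  assumes B: "B \<in> carrier_mat N N"
    and dvd: "\<And>i j. i < N \<Longrightarrow> j < N \<Longrightarrow> D j dvd B $$ (i, j)"
  shows "(\<Prod>j<N. D j) dvd det B"
proof -
  have "(\<Prod>j<N. D j) dvd signof \<sigma> * (\<Prod>i=0..<N. B $$ (i, \<sigma> i))"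
    if \<sigma>: "\<sigma> permutes {0..<N}" for \<sigma>
  proof -
    have "(\<Prod>j<N. D j) = (\<Prod>i=0..<N. D (\<sigma> i))"
      using prod.permute[OF \<sigma>, of D] by (simp add: lessThan_atLeast0 comp_def)
    also have "\<dots> dvd (\<Prod>i=0..<N. B $$ (i, \<sigma> i))"
      using permutes_in_image[OF \<sigma>] by (intro prod_dvd_prod dvd) auto
    finally show ?thesis by simp
  qed
  then show ?thesis
    unfolding det_def'[OF B] by (intro dvd_sum) auto
qed

text \<open>The quotient of \<open>r ^ j - s ^ j\<close> by \<open>r - s\<close>, written without
  division so that it is an integer and makes sense for \<open>r = s\<close>; it is 0 for
  \<open>j = 0\<close> and 1 for \<open>j = 1\<close>.\<close>

definition divided_diff_power :: "int \<Rightarrow> int \<Rightarrow> nat \<Rightarrow> int" where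
  "divided_diff_power r s j = (\<Sum>t<j. r ^ t * s ^ (j - Suc t))"

lemma divided_diff_power: "(r - s) * divided_diff_power r s j = r ^ j - s ^ j"
  by (simp add: divided_diff_power_def power_diff_sumr2 mult_ac)

text \<open>Unimodular column operations turn the first two columns into the values at \<open>r\<close> and the divided
  differences at \<open>r\<close>, \<open>s\<close> of the row polynomials.\<close>

lemma det_coeff_mat_column_ops:
  assumes deg: "\<And>i. i < N \<Longrightarrow> degree (f i) < N"
  obtains B where "B \<in> carrier_mat N N" "det B = det (coeff_mat N f)"
    "\<And>i. i < N \<Longrightarrow> 0 < N \<Longrightarrow> B $$ (i, 0) = poly (f i) r"
    "\<And>i. i < N \<Longrightarrow> 1 < N \<Longrightarrow> (r - s) * B $$ (i, 1) = poly (f i) r - poly (f i) s"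
proof -
  define U where "U = mat N N (\<lambda>(j, k). if k = 0 then r ^ j
      else if k = 1 then divided_diff_power r s j else if j = k then 1 else 0)"
  have U: "U \<in> carrier_mat N N" by (simp add: U_def)
  \<comment> \<open>\<open>U\<close> is lower triangular with unit diagonal: the divided difference
    vanishes at \<open>j = 0\<close> and equals 1 at \<open>j = 1\<close>.\<close>
  have "det U = prod_list (diag_mat U)"
  proof (rule det_lower_triangular[OF _ U])
    fix i j assume "i < j" "j < N"
    then show "U $$ (i, j) = 0"
      by (auto simp: U_def divided_diff_power_def)
  qed
  also have "diag_mat U = map (\<lambda>_. 1) [0..<N]"
    by (auto simp: diag_mat_def U_def divided_diff_power_def)
  finally have detU: "det U = 1" by (simp add: map_replicate_const)
  have ev: "poly (f i) x = (\<Sum>j=0..<N. coeff (f i) j * x ^ j)" if "i < N" for i x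
  proof -
    have "(\<Sum>j=0..<N. coeff (f i) j * x ^ j) = (\<Sum>j\<le>degree (f i). coeff (f i) j * x ^ j)"
      using deg[OF that] by (intro sum.mono_neutral_right) (auto simp: coeff_eq_0)
    then show ?thesis by (simp add: poly_altdef)
  qed
  define B where "B = coeff_mat N f * U"
  have idx: "B $$ (i, k) = (\<Sum>j=0..<N. coeff (f i) j * U $$ (j, k))" if "i < N" "k < N" for i k
    using that U by (auto simp: B_def coeff_mat_def scalar_prod_def intro!: sum.cong)
  show ?thesis
  proof
    show "B \<in> carrier_mat N N"
      unfolding B_def by (rule mult_carrier_mat[OF coeff_mat_carrier U])
    show "det B = det (coeff_mat N f)"
      unfolding B_def by (subst det_mult[OF coeff_mat_carrier U]) (simp add: detU)
    show "B $$ (i, 0) = poly (f i) r" if "i < N" "0 < N" for i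
      using that by (simp add: idx ev) (simp add: U_def)
    show "(r - s) * B $$ (i, 1) = poly (f i) r - poly (f i) s" if "i < N" "1 < N" for i
    proof -
      have "(r - s) * B $$ (i, 1) = (\<Sum>j=0..<N. coeff (f i) j * ((r - s) * divided_diff_power r s j))"
        using that by (simp add: idx sum_distrib_left) (simp add: U_def mult_ac)
      also have "\<dots> = poly (f i) r - poly (f i) s"
        using that by (simp add: ev divided_diff_power right_diff_distrib sum_subtractf)
      finally show ?thesis .
    qed
  qed
qed

text \<open>The column operations turn column 0 into the values at \<open>r\<close>, all divisible
  by \<open>d\<close>.\<close>

lemma dvd_det_coeff_mat:
  assumes deg: "\<And>i. i < N \<Longrightarrow> degree (f i) < N" and "0 < N"
    and "\<And>i. i < N \<Longrightarrow> d dvd poly (f i) r"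
  shows "d dvd det (coeff_mat N f)"
proof -
  obtain B where B: "B \<in> carrier_mat N N" "det B = det (coeff_mat N f)"
    "\<And>i. i < N \<Longrightarrow> 0 < N \<Longrightarrow> B $$ (i, 0) = poly (f i) r"
    using det_coeff_mat_column_ops[of N f r r] deg by metis
  have "(\<Prod>j<N. if j = 0 then d else 1) dvd det B"
    by (rule prod_column_divisors_dvd_det[OF B(1)]) (use B(3) assms in auto)
  with \<open>0 < N\<close> show ?thesis by (simp add: B(2) prod.delta)
qed

text \<open>After the column operations \<open>p\<close> divides two columns: the values at
  \<open>r\<close>, and the divided differences, because \<open>r - s\<close> can be cancelled
  modulo \<open>p\<close>.\<close>

lemma prime_square_dvd_det_coeff_mat:
  assumes deg: "\<And>i. i < N \<Longrightarrow> degree (f i) < N" and "1 < N"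
    and p: "prime p" "\<not> p dvd r - s"
    and r: "\<And>i. i < N \<Longrightarrow> p dvd poly (f i) r" and s: "\<And>i. i < N \<Longrightarrow> p dvd poly (f i) s"
  shows "p\<^sup>2 dvd det (coeff_mat N f)"
proof -
  obtain B where B: "B \<in> carrier_mat N N" "det B = det (coeff_mat N f)"
    "\<And>i. i < N \<Longrightarrow> 0 < N \<Longrightarrow> B $$ (i, 0) = poly (f i) r"
    "\<And>i. i < N \<Longrightarrow> 1 < N \<Longrightarrow> (r - s) * B $$ (i, 1) = poly (f i) r - poly (f i) s"
    using det_coeff_mat_column_ops[of N f r s] deg by metis
  have p1: "p dvd B $$ (i, 1)" if "i < N" for i
  proof -
    have "p dvd (r - s) * B $$ (i, 1)"
      using B(4)[OF that \<open>1 < N\<close>] r s that by simp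
    then show ?thesis using p by (simp add: prime_dvd_mult_iff)
  qed
  have "(\<Prod>j<N. if j = 0 \<or> j = 1 then p else 1) dvd det B"
    by (rule prod_column_divisors_dvd_det[OF B(1)]) (use B(3) p1 assms in auto)
  also have "(\<Prod>j<N. if j = 0 \<or> j = 1 then p else 1) = (\<Prod>j\<in>{0, 1::nat}. p)"
    using \<open>1 < N\<close> by (intro prod.mono_neutral_cong_right) auto
  finally show ?thesis by (simp add: B(2) power2_eq_square)
qed

section \<open>Resultants as Sylvester determinants\<close>

definition sylvester_rows :: "nat \<Rightarrow> int poly \<Rightarrow> int poly \<Rightarrow> nat \<Rightarrow> int poly" where
  "sylvester_rows n g h i = (if i < n then monom 1 i * g else monom 1 (i - n) * h)"

text \<open>A resultant computed as if both polynomials had degree \<open>n\<close>. The matrix then has size at least 2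
  even for \<open>n = 1\<close>, as needed for the divisibility by \<open>p\<^sup>2\<close> below.\<close>

definition sylvester_det :: "nat \<Rightarrow> int poly \<Rightarrow> int poly \<Rightarrow> int" where
  "sylvester_det n g h = det (coeff_mat (2 * n) (sylvester_rows n g h))"

lemma degree_sylvester_rows:
  assumes "i < 2 * n" "degree g \<le> n" "degree h \<le> n"
  shows "degree (sylvester_rows n g h i) < 2 * n"
proof -
  have "degree (monom 1 k * p :: int poly) \<le> k + degree p" for k p
    by (rule order_trans[OF degree_mult_le]) (simp add: degree_monom_le)
  from this[of i g] this[of "i - n" h] show ?thesis
    using assms by (auto simp: sylvester_rows_def)
qed

text \<open>Each row polynomial is a multiple of \<open>g\<close> or of \<open>h\<close>, hence
  vanishes at \<open>r\<close> modulo \<open>d\<close>.\<close>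

lemma dvd_sylvester_det:
  assumes "degree g \<le> n" "degree h \<le> n" "0 < n" "d dvd poly g r" "d dvd poly h r"
  shows "d dvd sylvester_det n g h"
  unfolding sylvester_det_def
  by (rule dvd_det_coeff_mat[of _ _ _ r]) (use assms degree_sylvester_rows in \<open>auto simp: sylvester_rows_def\<close>)

text \<open>Two common roots that differ modulo \<open>p\<close> allow two columns to be made
  divisible by \<open>p\<close>; \<open>0 < n\<close> guarantees that there are two columns.\<close>

lemma prime_square_dvd_sylvester_det:
  assumes "degree g \<le> n" "degree h \<le> n" "0 < n" "prime p" "\<not> p dvd r - s"
    "p dvd poly g r" "p dvd poly h r" "p dvd poly g s" "p dvd poly h s"
  shows "p\<^sup>2 dvd sylvester_det n g h"
  unfolding sylvester_det_def
  by (rule prime_square_dvd_det_coeff_mat[of _ _ p r s])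
    (use assms degree_sylvester_rows in \<open>auto simp: sylvester_rows_def\<close>)

text \<open>The Leibniz formula has \<open>fact (2 * n)\<close> terms, each with \<open>n\<close>
  factors from rows of \<open>g\<close> and \<open>n\<close> from rows of \<open>h\<close>.\<close>

lemma sylvester_det_bound:
  assumes g: "\<And>i. \<bar>coeff g i\<bar> \<le> G" and h: "\<And>i. \<bar>coeff h i\<bar> \<le> L"
  shows "\<bar>sylvester_det n g h\<bar> \<le> fact (2 * n) * G ^ n * L ^ n"
proof -
  let ?M = "coeff_mat (2 * n) (sylvester_rows n g h)"
  have G0: "0 \<le> G" and L0: "0 \<le> L" using g[of 0] h[of 0] by auto
  have entry: "\<bar>?M $$ (i, j)\<bar> \<le> (if i < n then G else L)" if "i < 2 * n" "j < 2 * n" for i j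
    using that g h G0 L0
    by (auto simp: coeff_mat_def sylvester_rows_def coeff_monom_mult)
  have "\<bar>signof \<sigma> * (\<Prod>i=0..<2*n. ?M $$ (i, \<sigma> i))\<bar> \<le> G ^ n * L ^ n"
    if \<sigma>: "\<sigma> permutes {0..<2*n}" for \<sigma>
  proof -
    have "\<bar>signof \<sigma> * (\<Prod>i=0..<2*n. ?M $$ (i, \<sigma> i))\<bar> = (\<Prod>i=0..<2*n. \<bar>?M $$ (i, \<sigma> i)\<bar>)"
      by (simp add: abs_mult abs_prod sign_def)
    also have "\<dots> \<le> (\<Prod>i=0..<2*n. if i < n then G else L)"
      using permutes_in_image[OF \<sigma>] by (intro prod_mono conjI entry) auto
    also have "\<dots> = (\<Prod>i=0..<n. if i < n then G else L) * (\<Prod>i=n..<2*n. if i < n then G else L)"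
      by (rule prod.atLeastLessThan_concat[symmetric]) auto
    also have "\<dots> = G ^ n * L ^ n" by simp
    finally show ?thesis .
  qed
  then have "\<bar>det ?M\<bar> \<le> (\<Sum>\<sigma> | \<sigma> permutes {0..<2*n}. G ^ n * L ^ n)"
    unfolding det_def'[OF coeff_mat_carrier] by (intro order_trans[OF sum_abs] sum_mono) auto
  also have "\<dots> = fact (2 * n) * G ^ n * L ^ n"
    by (simp add: card_permutations[of _ "2 * n"])
  finally show ?thesis by (simp add: sylvester_det_def)
qed

text \<open>A zero determinant yields a nontrivial relation \<open>u * g + w * h = 0\<close> with
  \<open>u\<close> and \<open>w\<close> of degree below \<open>n\<close>. Being prime,
  \<open>g\<close> divides \<open>w\<close> or \<open>h\<close>. It cannot divide the nonzero
  \<open>h\<close> of smaller degree, so it divides \<open>w\<close>, which forces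
  \<open>w = 0\<close> and then \<open>u = 0\<close>.\<close>

lemma sylvester_det_nonzero:
  assumes irr: "irreducible g" and deg: "degree g = n" "degree h < n" and "h \<noteq> 0"
  shows "sylvester_det n g h \<noteq> 0"
proof
  let ?f = "sylvester_rows n g h"
  let ?M = "coeff_mat (2 * n) ?f"
  assume "sylvester_det n g h = 0"
  \<comment> \<open>The rows hold the polynomials, so a linear relation between them is a kernel
    vector of the transpose.\<close>
  then have "det (transpose_mat ?M) = 0"
    by (simp add: sylvester_det_def det_transpose[OF coeff_mat_carrier])
  then obtain v where v: "v \<in> carrier_vec (2 * n)" "v \<noteq> 0\<^sub>v (2 * n)"
      and Mv: "transpose_mat ?M *\<^sub>v v = 0\<^sub>v (2 * n)"
    using det_0_iff_vec_prod_zero[of "transpose_mat ?M" "2 * n"] by auto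
  define u where "u = (\<Sum>i<n. monom (v $ i) i)"
  define w where "w = (\<Sum>i<n. monom (v $ (n + i)) i)"
  have cu: "coeff u i = (if i < n then v $ i else 0)" for i
    by (simp add: u_def coeff_sum sum.delta')
  have cw: "coeff w i = (if i < n then v $ (n + i) else 0)" for i
    by (simp add: w_def coeff_sum sum.delta')
  have comb: "u * g + w * h = (\<Sum>i=0..<2*n. smult (v $ i) (?f i))"
  proof -
    have m: "monom a k = smult a (monom 1 k)" for a :: int and k by (simp add: smult_monom)
    have "(\<Sum>i=0..<2*n. smult (v $ i) (?f i)) =
        (\<Sum>i=0..<n. smult (v $ i) (?f i)) + (\<Sum>i=n..<2*n. smult (v $ i) (?f i))"
      by (rule sum.atLeastLessThan_concat[symmetric]) auto
    also have "(\<Sum>i=n..<2*n. smult (v $ i) (?f i)) = (\<Sum>i=0..<n. smult (v $ (n + i)) (?f (n + i)))"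
      using sum.shift_bounds_nat_ivl[of "\<lambda>i. smult (v $ i) (?f i)" 0 n n]
      by (simp add: mult_2 add.commute)
    finally show ?thesis
      unfolding u_def w_def by (subst (1 2) m) (simp add: sum_distrib_right sylvester_rows_def lessThan_atLeast0)
  qed
  have "coeff (u * g + w * h) j = 0" for j
  proof (cases "j < 2 * n")
    case True
    have "(transpose_mat ?M *\<^sub>v v) $ j = 0" using Mv True by simp
    then show ?thesis
      using True v unfolding comb
      by (simp add: coeff_sum coeff_mat_def scalar_prod_def mult.commute)
  next
    case False
    have "coeff (?f i) j = 0" if "i < 2 * n" for i
      using degree_sylvester_rows[OF that, of g h] deg False by (intro coeff_eq_0) auto
    then show ?thesis unfolding comb by (simp add: coeff_sum)
  qed
  then have rel: "u * g + w * h = 0" by (simp add: poly_eq_iff)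
  then have "w * h = g * (- u)" by (simp add: algebra_simps eq_neg_iff_add_eq_0)
  then have "g dvd w * h" by (metis dvd_triv_left)
  then have gwh: "g dvd w \<or> g dvd h"
    using irr by (simp add: prime_elem_iff_irreducible prime_elem_dvd_mult_iff)
  have "\<not> g dvd h" using dvd_imp_degree_le[of g h] \<open>h \<noteq> 0\<close> deg by auto
  then have "g dvd w" using gwh by simp
  have "w = 0"
  proof (rule ccontr)
    assume "w \<noteq> 0"
    then have "n \<le> degree w" using dvd_imp_degree_le[OF \<open>g dvd w\<close>] deg by simp
    then have "coeff w (degree w) = 0" unfolding cw by simp
    with \<open>w \<noteq> 0\<close> show False by simp
  qed
  with rel irr have "u = 0" by auto
  have "v = 0\<^sub>v (2 * n)"
  proof
    fix i assume "i < dim_vec (0\<^sub>v (2 * n) :: int vec)"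
    then have "i < 2 * n" by simp
    show "v $ i = 0\<^sub>v (2 * n) $ i"
    proof (cases "i < n")
      case True
      then show ?thesis using cu[of i] \<open>u = 0\<close> by simp
    next
      case False
      then have "i - n < n" "n + (i - n) = i" using \<open>i < 2 * n\<close> by auto
      then show ?thesis using cw[of "i - n"] \<open>w = 0\<close> \<open>i < 2 * n\<close> by simp
    qed
  qed (use v in auto)
  with v(2) show False by simp
qed

section \<open>Roots of an irreducible polynomial modulo squarefree numbers\<close>

text \<open>One element per root rather than per modulus, so that counting reduces to injections of
  pairs. Only squarefree moduli occur in inclusion-exclusion.\<close>

definition root_pairs :: "int poly \<Rightarrow> int \<Rightarrow> (int \<times> int) set" where
  "root_pairs P Q = {(d, r). 1 \<le> d \<and> d \<le> Q \<and> squarefree d \<and> 0 \<le> r \<and> r < d \<and> d dvd poly P r}"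

text \<open>The sum of \<rho>(d)/d, with the number \<rho>(d) of roots modulo \<open>d\<close>
  spread over the individual pairs (see \<open>root_sum_altdef\<close>).\<close>

definition root_sum :: "int poly \<Rightarrow> int \<Rightarrow> real" where
  "root_sum P Q = (\<Sum>(d, r)\<in>root_pairs P Q. 1 / real_of_int d)"

lemma finite_root_pairs [simp]: "finite (root_pairs P Q)"
  by (rule finite_subset[of _ "{1..Q} \<times> {0..Q}"]) (auto simp: root_pairs_def)

text \<open>Otherwise the cofactor of \<open>gcd d z\<close> in \<open>d\<close> has a prime factor
  \<open>p\<close>. It divides \<open>d\<close>, hence \<open>z\<close> and the gcd, so
  \<open>p ^ 2\<close> divides \<open>d\<close>.\<close>

lemma squarefree_int_dvdI:
  fixes d z :: int
  assumes "squarefree d" and "\<And>p. prime p \<Longrightarrow> p dvd d \<Longrightarrow> p dvd z"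
  shows "d dvd z"
proof (rule ccontr)
  assume "\<not> d dvd z"
  obtain k where k: "d = gcd d z * k" by (metis dvdE gcd_dvd1)
  have "\<bar>k\<bar> \<noteq> 1"
  proof
    assume "\<bar>k\<bar> = 1"
    then have "d = gcd d z \<or> d = - gcd d z" using k by (metis abs_if minus_mult_right mult.right_neutral minus_minus)
    then have "d dvd z" by (metis gcd_dvd2 minus_dvd_iff)
    with \<open>\<not> d dvd z\<close> show False ..
  qed
  moreover have "k \<noteq> 0" using k assms(1) by auto
  ultimately obtain p where p: "prime p" "p dvd k"
    using prime_divisorE[of k] by (metis zdvd1_eq)
  then have "p dvd d" using k by (metis dvd_mult)
  then have "p dvd gcd d z" using assms(2)[OF p(1)] by simp
  then have "p ^ 2 dvd d" using k p(2) by (metis mult_dvd_mono power2_eq_square)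
  then have "is_unit p" using assms(1) by (auto simp: squarefree_def)
  with p(1) show False by auto
qed

text \<open>The \<open>(L + 1) ^ n\<close> polynomials with \<open>n\<close> coefficients in
  \<open>{0..L}\<close> outnumber the residues modulo \<open>d\<close>. Two of them agree at
  \<open>r\<close> modulo \<open>d\<close>, and \<open>h\<close> is their difference.\<close>

lemma pigeonhole_small_polynomial:
  fixes d r :: int and L n :: nat
  assumes d: "1 \<le> d" "d < int ((L + 1) ^ n)"
  shows "\<exists>h :: int poly. h \<noteq> 0 \<and> (\<forall>i\<ge>n. coeff h i = 0) \<and> (\<forall>i. \<bar>coeff h i\<bar> \<le> int L) \<and> d dvd poly h r"
proof -
  define X where "X = PiE {..<n} (\<lambda>_. {0..int L})"
  define \<phi> where "\<phi> = (\<lambda>a :: nat \<Rightarrow> int. (\<Sum>i<n. a i * r ^ i) mod d)"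
  have "finite X" unfolding X_def by (intro finite_PiE) auto
  have "card X = (L + 1) ^ n" by (simp add: X_def card_PiE nat_add_distrib)
  moreover have "card (\<phi> ` X) \<le> card {0..<d}"
    by (rule card_mono) (use d in \<open>auto simp: \<phi>_def\<close>)
  ultimately have "card (\<phi> ` X) < card X" using d by (simp add: nat_less_iff le_less_trans)
  then have "\<not> inj_on \<phi> X" by (rule pigeonhole)
  then obtain a b where ab: "a \<in> X" "b \<in> X" "\<phi> a = \<phi> b" "a \<noteq> b" by (auto simp: inj_on_def)
  define h where "h = (\<Sum>i<n. monom (a i - b i) i)"
  have ch: "coeff h i = (if i < n then a i - b i else 0)" for i
    by (simp add: h_def coeff_sum)
  have "\<exists>i<n. a i \<noteq> b i"
  proof (rule ccontr)
    assume "\<not> ?thesis"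
    then have "a = b" using ab(1,2) unfolding X_def by (intro PiE_ext) auto
    with ab(4) show False ..
  qed
  then have "h \<noteq> 0" using ch by (metis coeff_0 right_minus_eq)
  moreover have "\<bar>coeff h i\<bar> \<le> int L" for i
  proof (cases "i < n")
    case True
    then have "a i \<in> {0..int L}" "b i \<in> {0..int L}"
      using PiE_mem[OF ab(1)[unfolded X_def], of i] PiE_mem[OF ab(2)[unfolded X_def], of i] by simp_all
    then show ?thesis using True by (auto simp: ch)
  qed (simp add: ch)
  moreover have "poly h r = (\<Sum>i<n. a i * r ^ i) - (\<Sum>i<n. b i * r ^ i)"
    by (simp add: h_def poly_sum poly_monom algebra_simps sum_subtractf)
  then have "d dvd poly h r" using ab(3) by (simp add: \<phi>_def mod_eq_dvd_iff)
  ultimately show ?thesis using ch by (intro exI[of _ h]) simp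
qed

lemma card_bounded_polys:
  fixes L n :: nat
  defines "X \<equiv> {h :: int poly. (\<forall>i\<ge>n. coeff h i = 0) \<and> (\<forall>i. \<bar>coeff h i\<bar> \<le> int L)}"
  shows "finite X" and "card X \<le> (2 * L + 1) ^ n"
proof -
  define Y where "Y = PiE {..<n} (\<lambda>_. {- int L..int L})"
  have fY: "finite Y" unfolding Y_def by (intro finite_PiE) auto
  have cY: "card Y = (2 * L + 1) ^ n" by (simp add: Y_def card_PiE nat_add_distrib nat_mult_distrib)
  have inj: "inj_on (\<lambda>h. restrict (coeff h) {..<n}) X"
  proof (rule inj_onI)
    fix h k assume *: "h \<in> X" "k \<in> X" "restrict (coeff h) {..<n} = restrict (coeff k) {..<n}"
    have "coeff h i = coeff k i" for i
    proof (cases "i < n")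
      case True
      with fun_cong[OF *(3), of i] show ?thesis by simp
    next
      case False
      with *(1,2) show ?thesis by (simp add: X_def)
    qed
    then show "h = k" by (simp add: poly_eq_iff)
  qed
  have sub: "(\<lambda>h. restrict (coeff h) {..<n}) ` X \<subseteq> Y"
    unfolding Y_def by (rule image_subsetI) (auto simp: X_def abs_le_iff minus_le_iff restrict_PiE_iff)
  show "finite X" by (rule inj_on_finite[OF inj sub fY])
  show "card X \<le> (2 * L + 1) ^ n" using card_inj_on_le[OF inj sub fY] cY by simp
qed

text \<open>Serves to choose the coefficient box for the pigeonhole principle:
  \<open>(L + 1) ^ n\<close> exceeds all moduli in question, while \<open>L ^ n\<close> keeps the
  resultant of order \<open>X\<close>.\<close>

lemma ex_nat_root:
  fixes X n :: nat
  assumes "0 < n"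
  obtains L where "L ^ n \<le> X" "X < (L + 1) ^ n"
proof -
  define L where "L = (LEAST L. X < (L + 1) ^ n)"
  have "X < (X + 1) ^ n" using self_le_power[of "X + 1" n] assms by simp
  then have "X < (L + 1) ^ n" unfolding L_def by (rule LeastI)
  moreover have "L ^ n \<le> X"
  proof (cases L)
    case 0
    then show ?thesis using assms by (simp add: zero_power)
  next
    case (Suc l)
    then have "\<not> X < (l + 1) ^ n" using not_less_Least[of l "\<lambda>L. X < (L + 1) ^ n"] by (simp add: L_def)
    then show ?thesis using Suc by simp
  qed
  ultimately show ?thesis using that by blast
qed

text \<open>A root \<open>r\<close> of \<open>g\<close> modulo \<open>d\<close> stands for a degree-one ideal of norm \<open>d\<close>. By the pigeonhole
  principle it contains an element \<open>h\<close> of norm \<open>R = d m\<close> with \<open>m\<close> bounded, and \<open>d\<close>, \<open>r\<close> can be recovered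
  from \<open>h\<close>, \<open>m\<close> and \<open>r mod m\<close>: a prime \<open>p\<close> dividing \<open>d\<close> but not \<open>m\<close> divides \<open>R\<close> only once, so that
  \<open>g\<close> and \<open>h\<close> have just one common root modulo \<open>p\<close>.\<close>

lemma card_root_pairs_dyadic:
  assumes irr: "irreducible g" and deg: "0 < degree g"
  shows "\<exists>C\<ge>0. \<forall>x::nat. 1 \<le> x \<longrightarrow>
    real (card {(d, r). (d, r) \<in> root_pairs g (2 * int x) \<and> int x < d}) \<le> C * real x"
proof -
  define n where "n = degree g"
  have n: "0 < n" "degree g = n" using deg by (auto simp: n_def)
  define G where "G = (\<Sum>i\<le>n. \<bar>coeff g i\<bar>)"
  have G: "\<bar>coeff g i\<bar> \<le> G" for i
  proof (cases "i \<le> n")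
    case True
    then show ?thesis unfolding G_def by (intro member_le_sum) auto
  next
    case False
    then have "coeff g i = 0" using n by (intro coeff_eq_0) auto
    then show ?thesis by (simp add: G_def sum_nonneg)
  qed
  have G0: "0 \<le> G" using G[of 0] by linarith
  \<comment> \<open>Chosen so that \<open>\<bar>R s\<bar> \<le> K * x\<close>; since
    \<open>d > x\<close>, the cofactor satisfies \<open>\<bar>m s\<bar> \<le> K\<close>.\<close>
  define K :: int where "K = 2 * (fact (2 * n) * G ^ n)"
  have K0: "0 \<le> K" using G0 by (simp add: K_def)
  \<comment> \<open>A bound for the number of values of \<open>\<Phi>\<close>, divided by
    \<open>x\<close>: at most \<open>(3 * L) ^ n \<le> 3 ^ n * 2 * x\<close> polynomials,
    \<open>2 * K + 1\<close> cofactors and \<open>K + 1\<close> residues.\<close>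
  define C :: real where "C = real (3 ^ n * 2 * nat (2 * K + 1) * nat (K + 1))"
  show ?thesis
  proof (intro exI[of _ C] conjI allI impI)
    show "0 \<le> C" by (simp add: C_def)
    fix x :: nat assume x: "1 \<le> x"
    obtain L where L: "L ^ n \<le> 2 * x" "2 * x < (L + 1) ^ n" using ex_nat_root[OF n(1)] by blast
    have L1: "1 \<le> L"
    proof (rule ccontr)
      assume "\<not> ?thesis"
      then have "L = 0" by simp
      then show False using L(2) x by simp
    qed
    define S where "S = {(d, r). (d, r) \<in> root_pairs g (2 * int x) \<and> int x < d}"
    define X where "X = {h :: int poly. (\<forall>i\<ge>n. coeff h i = 0) \<and> (\<forall>i. \<bar>coeff h i\<bar> \<le> int L)}"
    have "\<exists>h. h \<in> X \<and> h \<noteq> 0 \<and> fst s dvd poly h (snd s)" if "s \<in> S" for s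
    proof -
      obtain d r where s: "s = (d, r)" by force
      have "1 \<le> d" "d \<le> int (2 * x)" using that by (auto simp: S_def s root_pairs_def)
      moreover have "int (2 * x) < int ((L + 1) ^ n)" using L(2) by (simp only: of_nat_less_iff)
      ultimately have "1 \<le> d" "d < int ((L + 1) ^ n)" by linarith+
      from pigeonhole_small_polynomial[OF this, of r] show ?thesis by (auto simp: X_def s)
    qed
    then have "\<exists>h. \<forall>s\<in>S. h s \<in> X \<and> h s \<noteq> 0 \<and> fst s dvd poly (h s) (snd s)"
      by (intro bchoice) blast
    then obtain h where h: "\<And>s. s \<in> S \<Longrightarrow> h s \<in> X \<and> h s \<noteq> 0 \<and> fst s dvd poly (h s) (snd s)"
      by blast
    define R where "R = (\<lambda>s. sylvester_det n g (h s))"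
    define m where "m = (\<lambda>s. R s div fst s)"
    define \<Phi> where "\<Phi> = (\<lambda>s. (h s, m s, snd s mod \<bar>m s\<bar>))"
    have degh: "degree (h s) < n" if "s \<in> S" for s
    proof -
      have "coeff (h s) i = 0" if "n \<le> i" for i using h[OF \<open>s \<in> S\<close>] that by (simp add: X_def)
      then show ?thesis using h[OF that] by (metis leading_coeff_0_iff not_less)
    qed
    have R0: "R s \<noteq> 0" if "s \<in> S" for s
      unfolding R_def using sylvester_det_nonzero[OF irr n(2) degh[OF that]] h[OF that] by simp
    have Rm: "R s = fst s * m s" if "s \<in> S" for s
    proof -
      have "fst s dvd poly g (snd s)" using that by (auto simp: S_def root_pairs_def)
      then have "fst s dvd R s" unfolding R_def
        using dvd_sylvester_det[of g n "h s" "fst s" "snd s"] n h[OF that] degh[OF that] by simp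
      then show ?thesis by (simp add: m_def)
    qed
    have mK: "\<bar>m s\<bar> \<le> K" if "s \<in> S" for s
    proof -
      have sx: "int x < fst s" using that by (auto simp: S_def)
      have "\<bar>R s\<bar> \<le> fact (2 * n) * G ^ n * int L ^ n"
        unfolding R_def using G h[OF that] by (intro sylvester_det_bound) (auto simp: X_def)
      also have "\<dots> \<le> fact (2 * n) * G ^ n * int (2 * x)"
        using L(1) G0 by (intro mult_left_mono) (simp_all flip: of_nat_power)
      also have "\<dots> = K * int x" by (simp add: K_def)
      finally have "fst s * \<bar>m s\<bar> \<le> K * int x" using Rm[OF that] sx by (simp add: abs_mult)
      moreover have "int x * \<bar>m s\<bar> \<le> fst s * \<bar>m s\<bar>" using sx by (intro mult_right_mono) auto
      ultimately have "int x * \<bar>m s\<bar> \<le> int x * K" by (simp add: mult.commute)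
      then show ?thesis using x by simp
    qed
    have m0: "m s \<noteq> 0" if "s \<in> S" for s using R0[OF that] Rm[OF that] by auto
    have inj: "inj_on \<Phi> S"
    proof (rule inj_onI)
      fix s t assume st: "s \<in> S" "t \<in> S" "\<Phi> s = \<Phi> t"
      then have eq: "h s = h t" "m s = m t" "snd s mod \<bar>m s\<bar> = snd t mod \<bar>m s\<bar>" by (auto simp: \<Phi>_def)
      have "fst s * m s = fst t * m s" using Rm[OF st(1)] Rm[OF st(2)] eq by (simp add: R_def)
      then have f: "fst s = fst t" using m0[OF st(1)] by simp
      have mdvd: "m s dvd snd s - snd t" using eq(3) by (simp add: mod_eq_dvd_iff)
      have sS: "squarefree (fst s)" "fst s dvd poly g (snd s)" "fst s dvd poly g (snd t)"
        using st f by (auto simp: S_def root_pairs_def)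
      have "fst s dvd snd s - snd t"
      proof (rule squarefree_int_dvdI[OF sS(1)], rule ccontr)
        \<comment> \<open>If \<open>p\<close> did not divide the difference of the roots,
          \<open>p\<^sup>2\<close> would divide \<open>R s = fst s * m s\<close>. As
          \<open>fst s\<close> is squarefree, \<open>p\<close> would divide \<open>m s\<close>,
          which does divide that difference.\<close>
        fix p assume p: "prime p" "p dvd fst s" "\<not> p dvd snd s - snd t"
        have "p\<^sup>2 dvd R s" unfolding R_def
          by (rule prime_square_dvd_sylvester_det[OF _ _ n(1) p(1) p(3)])
            (use n degh[OF st(1)] h[OF st(1)] h[OF st(2)] eq f p(2) sS in \<open>auto intro: dvd_trans\<close>)
        then have "p * p dvd fst s * m s" using Rm[OF st(1)] by (simp add: power2_eq_square)
        moreover obtain k where k: "fst s = p * k" using p(2) by blast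
        ultimately have "p dvd k * m s" using p(1) by (auto simp: mult.assoc)
        moreover have "\<not> p dvd k"
        proof
          assume "p dvd k"
          then have "p\<^sup>2 dvd fst s" using k by (simp add: power2_eq_square)
          then have "is_unit p" using sS(1) by (auto simp: squarefree_def)
          then show False using p(1) by auto
        qed
        ultimately have "p dvd m s" using p(1) by (simp add: prime_dvd_mult_iff)
        then show False using mdvd p(3) dvd_trans by blast
      qed
      then have "snd s mod fst s = snd t mod fst s" by (simp add: mod_eq_dvd_iff)
      moreover have "0 \<le> snd s" "snd s < fst s" "0 \<le> snd t" "snd t < fst s"
        using st f by (auto simp: S_def root_pairs_def)
      ultimately have "snd s = snd t" by simp
      with f show "s = t" by (simp add: prod_eq_iff)
    qed
    have sub: "\<Phi> ` S \<subseteq> X \<times> {-K..K} \<times> {0..K}"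
    proof
      fix y assume "y \<in> \<Phi> ` S"
      then obtain s where s: "s \<in> S" "y = \<Phi> s" by blast
      have "0 < \<bar>m s\<bar>" using m0[OF s(1)] by simp
      then have "0 \<le> snd s mod \<bar>m s\<bar>" "snd s mod \<bar>m s\<bar> < \<bar>m s\<bar>" by simp_all
      then show "y \<in> X \<times> {-K..K} \<times> {0..K}"
        using h[OF s(1)] mK[OF s(1)] by (auto simp: s(2) \<Phi>_def)
    qed
    have "card S \<le> card (X \<times> {-K..K} \<times> {0..K})"
      by (rule card_inj_on_le[OF inj sub]) (use card_bounded_polys(1)[of n L] in \<open>auto simp: X_def\<close>)
    also have "\<dots> = card X * (nat (2 * K + 1) * nat (K + 1))" by (simp add: card_cartesian_product add.commute)
    also have "\<dots> \<le> (2 * L + 1) ^ n * (nat (2 * K + 1) * nat (K + 1))"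
      using card_bounded_polys(2)[of n L] by (simp add: X_def)
    also have "(2 * L + 1) ^ n \<le> (3 * L) ^ n" using L1 by (intro power_mono) auto
    also have "(3 * L) ^ n \<le> 3 ^ n * (2 * x)" using L(1) by (simp add: power_mult_distrib)
    finally have "card S \<le> 3 ^ n * (2 * x) * (nat (2 * K + 1) * nat (K + 1))" by simp
    then have "real (card S) \<le> real (3 ^ n * (2 * x) * (nat (2 * K + 1) * nat (K + 1)))"
      by (simp only: of_nat_le_iff)
    also have "\<dots> = C * real x" by (simp add: C_def)
    finally show "real (card {(d, r). (d, r) \<in> root_pairs g (2 * int x) \<and> int x < d}) \<le> C * real x"
      by (simp add: S_def)
  qed
qed

section \<open>Logarithmic growth for one irreducible factor\<close>

lemma root_sum_mono: "Q \<le> Q' \<Longrightarrow> root_sum P Q \<le> root_sum P Q'"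
  unfolding root_sum_def by (rule sum_mono2[OF finite_root_pairs]) (auto simp: root_pairs_def)

text \<open>A dyadic block \<open>x < d \<le> 2 * x\<close> holds at most \<open>C * x\<close> pairs
  of weight below \<open>1 / x\<close>, so each doubling of \<open>Q\<close> adds at most
  \<open>C\<close>.\<close>

lemma root_sum_irreducible:
  assumes irr: "irreducible g" and deg: "0 < degree g"
  shows "\<exists>C\<ge>0. \<forall>Q::int. 2 \<le> Q \<longrightarrow> root_sum g Q \<le> C * ln (real_of_int Q)"
proof -
  obtain C where C: "0 \<le> C"
    "\<And>x::nat. 1 \<le> x \<Longrightarrow> real (card {(d, r). (d, r) \<in> root_pairs g (2 * int x) \<and> int x < d}) \<le> C * real x"
    using card_root_pairs_dyadic[OF irr deg] by blast
  have pow: "root_sum g (2 ^ k) \<le> 1 + C * real k" for k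
  proof (induction k)
    case 0
    have "root_pairs g 1 \<subseteq> {(1, 0)}" by (auto simp: root_pairs_def)
    then have "root_sum g 1 \<le> (\<Sum>(d, r)\<in>{(1 :: int, 0 :: int)}. 1 / real_of_int d)"
      unfolding root_sum_def by (intro sum_mono2) auto
    then show ?case by simp
  next
    case (Suc k)
    define x :: nat where "x = 2 ^ k"
    have x: "1 \<le> x" "int x = 2 ^ k" by (simp_all add: x_def)
    define T where "T = {(d, r). (d, r) \<in> root_pairs g (2 * int x) \<and> int x < d}"
    have "root_pairs g (2 ^ Suc k) = root_pairs g (2 ^ k) \<union> T" "root_pairs g (2 ^ k) \<inter> T = {}"
      by (auto simp: T_def x(2) root_pairs_def)
    moreover have fT: "finite T"
      by (rule finite_subset[OF _ finite_root_pairs[of g "2 * int x"]]) (auto simp: T_def)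
    ultimately have "root_sum g (2 ^ Suc k) = root_sum g (2 ^ k) + (\<Sum>(d, r)\<in>T. 1 / real_of_int d)"
      unfolding root_sum_def by (simp add: sum.union_disjoint)
    moreover have "(\<Sum>(d, r)\<in>T. 1 / real_of_int d) \<le> (\<Sum>s\<in>T. 1 / real x)"
      using x(1) by (intro sum_mono) (auto simp: T_def intro!: divide_left_mono)
    moreover have "(\<Sum>s\<in>T. 1 / real x) \<le> C"
      using C(2)[OF x(1)] x(1) by (simp add: T_def field_simps)
    ultimately show ?case using Suc by (simp add: algebra_simps)
  qed
  show ?thesis
  \<comment> \<open>With \<open>y = log 2 Q \<ge> 1\<close> and
    \<open>k \<le> y + 1 \<le> 2 * y\<close>, the bound \<open>1 + C * k\<close> is at most
    \<open>(1 + 2 * C) * y\<close>.\<close>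
  proof (intro exI[of _ "(1 + 2 * C) / ln 2"] conjI allI impI)
    show "0 \<le> (1 + 2 * C) / ln 2" using C(1) by simp
    fix Q :: int assume Q: "2 \<le> Q"
    define y where "y = log 2 (real_of_int Q)"
    have y1: "1 \<le> y" using Q by (simp add: y_def le_log_iff)
    define k where "k = nat \<lceil>y\<rceil>"
    have k: "y \<le> real k" "real k \<le> y + 1" using y1 by (auto simp: k_def)
    have "real_of_int Q = 2 powr y" using Q by (simp add: y_def)
    also have "\<dots> \<le> 2 powr (real k)" using k(1) by simp
    also have "\<dots> = real_of_int (2 ^ k)" by (simp add: powr_realpow)
    finally have "Q \<le> 2 ^ k" by (simp only: of_int_le_iff)
    then have "root_sum g Q \<le> root_sum g (2 ^ k)" by (rule root_sum_mono)
    also have "\<dots> \<le> 1 + C * real k" by (rule pow)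
    also have "\<dots> \<le> y + C * (2 * y)" using k(2) y1 C(1) by (intro add_mono mult_left_mono) auto
    also have "\<dots> = (1 + 2 * C) / ln 2 * ln (real_of_int Q)" by (simp add: y_def log_def field_simps)
    finally show "root_sum g Q \<le> (1 + 2 * C) / ln 2 * ln (real_of_int Q)" .
  qed
qed

section \<open>Products of polynomials\<close>

lemma diff_dvd_poly_diff: "(a - b :: int) dvd poly P a - poly P b"
proof (induction P)
  case (pCons c P)
  have "poly (pCons c P) a - poly (pCons c P) b = a * (poly P a - poly P b) + (a - b) * poly P b"
    by (simp add: algebra_simps)
  with pCons.IH show ?case by simp
qed simp

lemma dvd_poly_cong:
  fixes d a b :: int
  assumes "a mod d = b mod d"
  shows "d dvd poly P a \<longleftrightarrow> d dvd poly P b"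
proof -
  have "d dvd a - b" using assms by (simp add: mod_eq_dvd_iff)
  then have "d dvd poly P a - poly P b" using diff_dvd_poly_diff dvd_trans by blast
  then show ?thesis by (metis diff_add_cancel dvd_add_right_iff dvd_diff_commute)
qed

lemma dvd_poly_mod_iff: "(d::int) dvd poly P (a mod d) \<longleftrightarrow> d dvd poly P a"
  by (rule dvd_poly_cong) simp

text \<open>For a root \<open>r\<close> of \<open>G * H\<close> modulo a squarefree
  \<open>d\<close>, let \<open>d1\<close> be the gcd of \<open>d\<close> and the value of
  \<open>G\<close> at \<open>r\<close>, and \<open>d2 = d / d1\<close>. These are coprime,
  \<open>r\<close> is a root of \<open>G\<close> modulo \<open>d1\<close> and of \<open>H\<close>
  modulo \<open>d2\<close>, and by the Chinese remainder theorem the two reduced pairs determine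
  \<open>(d, r)\<close>. The weight \<open>1 / d\<close> is the product of the weights
  \<open>1 / d1\<close> and \<open>1 / d2\<close>.\<close>

lemma root_sum_mult: "root_sum (G * H) Q \<le> root_sum G Q * root_sum H Q"
proof -
  define d1 where "d1 = (\<lambda>s :: int \<times> int. gcd (fst s) (poly G (snd s)))"
  define d2 where "d2 = (\<lambda>s. fst s div d1 s)"
  define \<Phi> where "\<Phi> = (\<lambda>s. ((d1 s, snd s mod d1 s), (d2 s, snd s mod d2 s)))"
  have split: "fst s = d1 s * d2 s \<and> 1 \<le> d1 s \<and> 1 \<le> d2 s \<and> coprime (d1 s) (d2 s)"
    if "s \<in> root_pairs (G * H) Q" for s
  proof -
    have s: "1 \<le> fst s" "squarefree (fst s)" using that by (auto simp: root_pairs_def)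
    have eq: "fst s = d1 s * d2 s" by (simp add: d1_def d2_def)
    have 1: "1 \<le> d1 s" using s by (auto simp: d1_def) (smt (verit) gcd_pos_int)
    then have 2: "1 \<le> d2 s" using eq s(1) by (smt (verit) mult_le_0_iff)
    have "coprime (d1 s) (d2 s)"
    proof (rule coprimeI)
      fix c assume "c dvd d1 s" "c dvd d2 s"
      then have "c\<^sup>2 dvd fst s" using eq by (metis mult_dvd_mono power2_eq_square)
      then show "is_unit c" using s(2) by (auto simp: squarefree_def)
    qed
    with eq 1 2 show ?thesis by blast
  qed
  have inj: "inj_on \<Phi> (root_pairs (G * H) Q)"
  proof (rule inj_onI)
    fix s t assume st: "s \<in> root_pairs (G * H) Q" "t \<in> root_pairs (G * H) Q" "\<Phi> s = \<Phi> t"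
    then have eq: "d1 s = d1 t" "d2 s = d2 t" "snd s mod d1 s = snd t mod d1 s"
      "snd s mod d2 s = snd t mod d2 s" by (auto simp: \<Phi>_def)
    have f: "fst s = fst t" using split[OF st(1)] split[OF st(2)] eq by simp
    have "d1 s dvd snd s - snd t" "d2 s dvd snd s - snd t" using eq by (simp_all add: mod_eq_dvd_iff)
    then have "fst s dvd snd s - snd t" using split[OF st(1)] by (simp add: divides_mult)
    then have "snd s mod fst s = snd t mod fst s" by (simp add: mod_eq_dvd_iff)
    moreover have "0 \<le> snd s" "snd s < fst s" "0 \<le> snd t" "snd t < fst s"
      using st f by (auto simp: root_pairs_def)
    ultimately have "snd s = snd t" by simp
    with f show "s = t" by (simp add: prod_eq_iff)
  qed
  have sub: "\<Phi> ` root_pairs (G * H) Q \<subseteq> root_pairs G Q \<times> root_pairs H Q"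
  proof (rule image_subsetI)
    fix s assume s: "s \<in> root_pairs (G * H) Q"
    have sp: "fst s \<le> Q" "1 \<le> fst s" "squarefree (fst s)" "fst s dvd poly G (snd s) * poly H (snd s)"
      using s by (auto simp: root_pairs_def)
    have dvd: "d1 s dvd fst s" "d2 s dvd fst s" using split[OF s] by simp_all
    have "d1 s \<le> fst s" "d2 s \<le> fst s"
      using dvd sp(2) by (auto intro!: zdvd_imp_le)
    then have le: "d1 s \<le> Q" "d2 s \<le> Q" using sp(1) by linarith+
    have sq: "squarefree (d1 s)" "squarefree (d2 s)"
      using dvd sp(3) squarefree_mono by blast+
    have g: "d1 s dvd poly G (snd s)" by (simp add: d1_def)
    have h: "d2 s dvd poly H (snd s)"
    proof -
      obtain k where k: "poly G (snd s) = d1 s * k" using g by blast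
      \<comment> \<open>\<open>d1 s\<close> is the whole gcd, so the cofactor \<open>k\<close>
        shares nothing with \<open>d2 s\<close>, and \<open>d2 s\<close> must divide the value of
        \<open>H\<close>.\<close>
      have "d1 s = d1 s * gcd (d2 s) k"
      proof -
        have "d1 s = gcd (d1 s * d2 s) (d1 s * k)" using split[OF s] k by (metis d1_def)
        also have "\<dots> = d1 s * gcd (d2 s) k" 
          using gcd_mult_distrib_int[of "d1 s" "d2 s" k] split[OF s] by linarith
        finally show ?thesis .
      qed
      then have "coprime (d2 s) k" using split[OF s] by (simp add: coprime_iff_gcd_eq_1)
      moreover have "d1 s * d2 s dvd d1 s * (k * poly H (snd s))"
        using sp(4) split[OF s] k by (simp add: mult.assoc)
      then have "d2 s dvd k * poly H (snd s)" using split[OF s] by simp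
      ultimately show ?thesis by (simp add: coprime_dvd_mult_right_iff)
    qed
    show "\<Phi> s \<in> root_pairs G Q \<times> root_pairs H Q"
      using split[OF s] le sq g h by (auto simp: \<Phi>_def root_pairs_def dvd_poly_mod_iff)
  qed
  have "root_sum (G * H) Q = (\<Sum>s\<in>root_pairs (G * H) Q. 1 / real_of_int (fst s))"
    by (simp add: root_sum_def case_prod_unfold)
  also have "\<dots> = (\<Sum>s\<in>root_pairs (G * H) Q. 1 / real_of_int (fst (fst (\<Phi> s))) * (1 / real_of_int (fst (snd (\<Phi> s)))))"
    using split by (intro sum.cong) (auto simp: \<Phi>_def)
  also have "\<dots> = (\<Sum>(u, v)\<in>\<Phi> ` root_pairs (G * H) Q. 1 / real_of_int (fst u) * (1 / real_of_int (fst v)))"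
    by (simp add: sum.reindex[OF inj] case_prod_unfold)
  also have "\<dots> \<le> (\<Sum>(u, v)\<in>root_pairs G Q \<times> root_pairs H Q. 1 / real_of_int (fst u) * (1 / real_of_int (fst v)))"
    by (intro sum_mono2[OF _ sub] finite_cartesian_product finite_root_pairs) (auto simp: root_pairs_def)
  also have "\<dots> = root_sum G Q * root_sum H Q"
    by (simp add: root_sum_def case_prod_unfold sum_product sum.cartesian_product)
  finally show ?thesis .
qed

lemma root_sum_nonneg: "0 \<le> root_sum P Q"
  unfolding root_sum_def by (rule sum_nonneg) (auto simp: root_pairs_def)

lemma root_sum_le_card: "root_sum P Q \<le> real (card (root_pairs P Q))"
proof -
  have "root_sum P Q \<le> (\<Sum>s\<in>root_pairs P Q. 1)"
    unfolding root_sum_def by (rule sum_mono) (auto simp: root_pairs_def)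
  then show ?thesis by simp
qed

lemma root_sum_prod:
  assumes "finite A"
  shows "root_sum (\<Prod>g\<in>A. f g) Q \<le> (\<Prod>g\<in>A. root_sum (f g) Q)"
  using assms
proof (induction A rule: finite_induct)
  case empty
  have "root_pairs 1 Q \<subseteq> {(1, 0)}" by (auto simp: root_pairs_def)
  then have "card (root_pairs 1 Q) \<le> card {(1 :: int, 0 :: int)}" by (intro card_mono) auto
  with root_sum_le_card[of 1 Q] show ?case by simp
next
  case (insert x A)
  have "root_sum (f x * (\<Prod>g\<in>A. f g)) Q \<le> root_sum (f x) Q * root_sum (\<Prod>g\<in>A. f g) Q"
    by (rule root_sum_mult)
  also have "\<dots> \<le> root_sum (f x) Q * (\<Prod>g\<in>A. root_sum (f g) Q)"
    using insert.IH by (intro mult_left_mono root_sum_nonneg)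
  finally show ?case using insert by simp
qed

text \<open>Only divisors \<open>d\<close> of \<open>c\<close> admit roots, so the sum stays bounded
  as \<open>Q\<close> grows.\<close>

lemma root_sum_const:
  assumes "c \<noteq> 0"
  shows "root_sum [:c:] Q \<le> real_of_int (\<bar>c\<bar> * (\<bar>c\<bar> + 1))"
proof -
  have "root_pairs [:c:] Q \<subseteq> {1..\<bar>c\<bar>} \<times> {0..\<bar>c\<bar>}"
  proof (rule subrelI)
    fix d r assume "(d, r) \<in> root_pairs [:c:] Q"
    then have *: "1 \<le> d" "0 \<le> r" "r < d" "d dvd c" by (auto simp: root_pairs_def)
    then have "d \<le> \<bar>c\<bar>" using assms by (intro zdvd_imp_le) auto
    with * show "(d, r) \<in> {1..\<bar>c\<bar>} \<times> {0..\<bar>c\<bar>}" by simp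
  qed
  then have "card (root_pairs [:c:] Q) \<le> card ({1..\<bar>c\<bar>} \<times> {0..\<bar>c\<bar>})" by (intro card_mono) auto
  also have "\<dots> = nat (\<bar>c\<bar> * (\<bar>c\<bar> + 1))" by (simp add: card_cartesian_product nat_mult_distrib)
  finally have "real (card (root_pairs [:c:] Q)) \<le> real (nat (\<bar>c\<bar> * (\<bar>c\<bar> + 1)))" by (simp only: of_nat_le_iff)
  with root_sum_le_card[of "[:c:]" Q] show ?thesis by simp
qed

text \<open>Divisibility by a squarefree \<open>d\<close> is tested prime by prime, so
  multiplicities of the factors do not matter. The factors are taken in \<open>int poly\<close> and
  include the primes of the content.\<close>

lemma root_pairs_prime_factors:
  assumes "P \<noteq> 0"
  shows "root_pairs P Q \<subseteq> root_pairs (\<Prod>g\<in>prime_factors P. g) Q"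
proof -
  have ex: "\<exists>g\<in>#M. p dvd poly g r" if "prime p" "p dvd poly (prod_mset M) r" for p r :: int and M
    using that by (induction M) (auto simp: prime_dvd_mult_iff)
  have "d dvd poly (\<Prod>g\<in>prime_factors P. g) r" if d: "squarefree d" "d dvd poly P r" for d r
  proof (rule squarefree_int_dvdI[OF d(1)])
    fix p assume p: "prime p" "p dvd d"
    have "P dvd prod_mset (prime_factorization P)"
      using prod_mset_prime_factorization_weak[OF assms] by (metis dvd_normalize_iff dvd_refl normalize_dvd_iff)
    then have "poly P r dvd poly (prod_mset (prime_factorization P)) r" by (metis dvdE dvdI poly_mult)
    then have "p dvd poly (prod_mset (prime_factorization P)) r" using p(2) d(2) dvd_trans by blast
    then obtain g where g: "g \<in> prime_factors P" "p dvd poly g r" using ex[OF p(1)] by blast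
    have "poly g r dvd (\<Prod>g\<in>prime_factors P. poly g r)" using g(1) by (intro dvd_prodI) auto
    then show "p dvd poly (\<Prod>g\<in>prime_factors P. g) r" using g(2) dvd_trans by (fastforce simp: poly_prod)
  qed
  then show ?thesis by (auto simp: root_pairs_def)
qed

text \<open>Submultiplicativity leaves one logarithm for each prime factor of positive degree; the
  constant ones, primes of the content, only affect \<open>C\<close>.\<close>

lemma root_sum_bound:
  assumes "P \<noteq> 0"
  shows "\<exists>C\<ge>0. \<forall>Q::int. 2 \<le> Q \<longrightarrow>
    root_sum P Q \<le> C * ln (real_of_int Q) ^ num_irreducible_factors P"
proof -
  define A where "A = prime_factors P"
  have "\<exists>C\<ge>0. \<forall>Q::int. 2 \<le> Q \<longrightarrow> root_sum g Q \<le> C * (if 0 < degree g then ln (real_of_int Q) else 1)"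
    if "g \<in> A" for g
  proof (cases "0 < degree g")
    case True
    have "irreducible g" using that by (auto simp: A_def in_prime_factors_iff prime_def prime_elem_iff_irreducible)
    from root_sum_irreducible[OF this True] True show ?thesis by simp
  next
    case False
    then obtain c where c: "g = [:c:]" by (auto elim: degree_eq_zeroE)
    moreover have "c \<noteq> 0" using that c by (auto simp: A_def)
    ultimately show ?thesis using root_sum_const[of c] False
      by (intro exI[of _ "real_of_int (\<bar>c\<bar> * (\<bar>c\<bar> + 1))"]) auto
  qed
  then have "\<forall>g\<in>A. \<exists>C. 0 \<le> C \<and> (\<forall>Q::int. 2 \<le> Q \<longrightarrow> root_sum g Q \<le> C * (if 0 < degree g then ln (real_of_int Q) else 1))"
    by blast
  from bchoice[OF this] obtain C where C: "\<And>g. g \<in> A \<Longrightarrow> 0 \<le> C g"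
    "\<And>g Q. g \<in> A \<Longrightarrow> 2 \<le> Q \<Longrightarrow> root_sum g Q \<le> C g * (if 0 < degree g then ln (real_of_int Q) else 1)"
    by blast
  have J: "{g. irreducible g \<and> 0 < degree g \<and> normalize g = g \<and> g dvd P} = {g\<in>A. 0 < degree g}"
    using assms by (auto simp: A_def in_prime_factors_iff prime_def prime_elem_iff_irreducible)
  show ?thesis
  proof (intro exI[of _ "\<Prod>g\<in>A. C g"] conjI allI impI)
    show "0 \<le> (\<Prod>g\<in>A. C g)" using C(1) by (simp add: prod_nonneg)
    fix Q :: int assume Q: "2 \<le> Q"
    have "root_sum P Q \<le> root_sum (\<Prod>g\<in>A. g) Q"
      unfolding root_sum_def A_def using root_pairs_prime_factors[OF assms]
      by (intro sum_mono2[OF finite_root_pairs]) (auto simp: root_pairs_def)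
    also have "\<dots> \<le> (\<Prod>g\<in>A. root_sum g Q)" by (rule root_sum_prod) (simp add: A_def)
    also have "\<dots> \<le> (\<Prod>g\<in>A. C g * (if 0 < degree g then ln (real_of_int Q) else 1))"
      using C(2)[OF _ Q] by (intro prod_mono conjI root_sum_nonneg)
    also have "\<dots> = (\<Prod>g\<in>A. C g) * ln (real_of_int Q) ^ num_irreducible_factors P"
      unfolding num_irreducible_factors_def J prod.distrib
      by (subst prod.inter_filter[symmetric]) (simp_all add: A_def)
    finally show "root_sum P Q \<le> (\<Prod>g\<in>A. C g) * ln (real_of_int Q) ^ num_irreducible_factors P" .
  qed
qed

section \<open>Equidistribution of the numerators\<close>

definition num_roots_mod :: "int poly \<Rightarrow> int \<Rightarrow> nat" where
  "num_roots_mod P d = card {r. 0 \<le> r \<and> r < d \<and> d dvd poly P r}"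

text \<open>The required divisor \<open>e\<close> is there for the induction over \<open>T\<close>:
  sieving out one more prime \<open>p\<close> subtracts the count with \<open>e * p\<close> in place
  of \<open>e\<close>.\<close>

definition sieve_count :: "int poly \<Rightarrow> int \<Rightarrow> int set \<Rightarrow> int \<Rightarrow> nat" where
  "sieve_count P e T m = card {a\<in>{1..m}. e dvd poly P a \<and> (\<forall>p\<in>T. \<not> p dvd poly P a)}"

text \<open>Reduction modulo \<open>e\<close> maps any \<open>e\<close> consecutive integers
  bijectively to the residues; its inverse picks the representative in the block.\<close>

lemma card_roots_block:
  assumes "1 \<le> e"
  shows "card {a\<in>{b+1..b+e}. e dvd poly P a} = num_roots_mod P e"
proof -
  have "bij_betw (\<lambda>a. a mod e) {a\<in>{b+1..b+e}. e dvd poly P a} {r. 0 \<le> r \<and> r < e \<and> e dvd poly P r}"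
  proof (rule bij_betwI[where g = "\<lambda>r. b + 1 + (r - (b + 1)) mod e"])
    show "(\<lambda>a. a mod e) \<in> {a\<in>{b+1..b+e}. e dvd poly P a} \<rightarrow> {r. 0 \<le> r \<and> r < e \<and> e dvd poly P r}"
      using assms by (auto simp: dvd_poly_mod_iff)
    show "(\<lambda>r. b + 1 + (r - (b + 1)) mod e) \<in> {r. 0 \<le> r \<and> r < e \<and> e dvd poly P r} \<rightarrow> {a\<in>{b+1..b+e}. e dvd poly P a}"
    proof (rule Pi_I)
      fix r assume r: "r \<in> {r. 0 \<le> r \<and> r < e \<and> e dvd poly P r}"
      let ?a = "b + 1 + (r - (b + 1)) mod e"
      have "?a mod e = r mod e" by (simp add: mod_add_right_eq)
      then have "e dvd poly P ?a" using r dvd_poly_cong by blast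
      moreover have "0 \<le> (r - (b + 1)) mod e" "(r - (b + 1)) mod e < e" using assms by simp_all
      ultimately show "?a \<in> {a\<in>{b+1..b+e}. e dvd poly P a}" by auto
    qed
    show "b + 1 + (a mod e - (b + 1)) mod e = a" if "a \<in> {a\<in>{b+1..b+e}. e dvd poly P a}" for a
    proof -
      have "(a mod e - (b + 1)) mod e = (a - (b + 1)) mod e" by (simp add: mod_diff_left_eq)
      also have "\<dots> = a - (b + 1)" using that by (intro mod_pos_pos_trivial) auto
      finally show ?thesis by simp
    qed
    show "(b + 1 + (r - (b + 1)) mod e) mod e = r" if "r \<in> {r. 0 \<le> r \<and> r < e \<and> e dvd poly P r}" for r
      using that by (simp add: mod_add_right_eq)
  qed
  then show ?thesis unfolding num_roots_mod_def by (rule bij_betw_same_card)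
qed

lemma sieve_count_empty_multiple:
  assumes "1 \<le> e"
  shows "sieve_count P e {} (int k * e) = k * num_roots_mod P e"
proof (induction k)
  case 0
  show ?case by (simp add: sieve_count_def)
next
  case (Suc k)
  have "{a\<in>{1..int (Suc k) * e}. e dvd poly P a} =
      {a\<in>{1..int k * e}. e dvd poly P a} \<union> {a\<in>{int k * e + 1..int k * e + e}. e dvd poly P a}"
  proof -
    define b where "b = int k * e"
    have "0 \<le> b" "int (Suc k) * e = b + e" using assms by (auto simp: b_def algebra_simps)
    then have "{1..int (Suc k) * e} = {1..int k * e} \<union> {int k * e + 1..int k * e + e}"
      using assms unfolding b_def[symmetric] by auto
    then show ?thesis by blast
  qed
  moreover have fin: "finite {a\<in>{x..y}. e dvd poly P a}" for x y
    by (rule finite_subset[of _ "{x..y}"]) auto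
  moreover have "{a\<in>{1..int k * e}. e dvd poly P a} \<inter> {a\<in>{int k * e + 1..int k * e + e}. e dvd poly P a} = {}"
    by auto
  ultimately have "card {a\<in>{1..int (Suc k) * e}. e dvd poly P a} =
      card {a\<in>{1..int k * e}. e dvd poly P a} + card {a\<in>{int k * e + 1..int k * e + e}. e dvd poly P a}"
    by (simp only: card_Un_disjoint[OF fin fin])
  with Suc card_roots_block[OF assms] show ?case by (simp add: sieve_count_def)
qed

lemma sieve_count_mono: "m \<le> m' \<Longrightarrow> sieve_count P e T m \<le> sieve_count P e T m'"
  unfolding sieve_count_def by (rule card_mono[OF finite_Collect_conjI]) auto

text \<open>With \<open>k\<close> the number of full periods of length \<open>e\<close> up to
  \<open>\<alpha> * q\<close>, the first count lies between \<open>k\<close> and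
  \<open>k + 1\<close> times the number of roots modulo \<open>e\<close>. So does the second term,
  since \<open>q\<close> consists of full periods.\<close>

lemma sieve_count_empty_discrepancy:
  fixes \<alpha> :: real
  assumes "1 \<le> e" "e dvd q" "1 \<le> q" "0 \<le> \<alpha>"
  shows "\<bar>real (sieve_count P e {} \<lfloor>\<alpha> * q\<rfloor>) - \<alpha> * real (sieve_count P e {} q)\<bar> \<le> real (num_roots_mod P e)"
proof -
  obtain t where t: "q = int t * e"
    using assms(1-3) by (metis dvdE mult.commute nonneg_int_cases zero_le_mult_iff zero_less_one_class.zero_le_one order_trans not_one_le_zero)
  let ?\<rho> = "real (num_roots_mod P e)"
  define y where "y = \<alpha> * real t"
  define k where "k = nat \<lfloor>y\<rfloor>"
  have y0: "0 \<le> y" using assms(4) by (simp add: y_def)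
  have ky: "real k \<le> y" "y \<le> real k + 1" using y0 by (auto simp: k_def)
  have q: "\<alpha> * real_of_int q = y * real_of_int e" by (simp add: t y_def)
  have e0: "0 < real_of_int e" using assms(1) by simp
  have lo: "int k * e \<le> \<lfloor>\<alpha> * q\<rfloor>"
    unfolding le_floor_iff q using ky(1) e0 by (simp add: mult_right_mono)
  have hi: "\<lfloor>\<alpha> * q\<rfloor> \<le> int (Suc k) * e"
  proof -
    have "\<alpha> * q \<le> real_of_int (int (Suc k) * e)" unfolding q using ky(2) e0 by (simp add: mult_right_mono)
    then show ?thesis by linarith
  qed
  have 1: "real k * ?\<rho> \<le> real (sieve_count P e {} \<lfloor>\<alpha> * q\<rfloor>)"
    using sieve_count_mono[OF lo, of P e "{}"] sieve_count_empty_multiple[OF assms(1), of P k]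
    by (metis of_nat_le_iff of_nat_mult)
  have 2: "real (sieve_count P e {} \<lfloor>\<alpha> * q\<rfloor>) \<le> real (Suc k) * ?\<rho>"
    using sieve_count_mono[OF hi, of P e "{}"] sieve_count_empty_multiple[OF assms(1), of P "Suc k"]
    by (metis of_nat_le_iff of_nat_mult)
  have 3: "\<alpha> * real (sieve_count P e {} q) = y * ?\<rho>"
    using sieve_count_empty_multiple[OF assms(1), of P t] by (simp add: t y_def)
  have "real k * ?\<rho> \<le> y * ?\<rho>" "y * ?\<rho> \<le> (real k + 1) * ?\<rho>"
    using ky by (intro mult_right_mono; simp)+
  with 1 2 3 show ?thesis by (simp add: abs_le_iff algebra_simps)
qed

lemma sum_Pow_insert:
  fixes f :: "'a set \<Rightarrow> 'b :: comm_monoid_add"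
  assumes "finite T" "p \<notin> T"
  shows "(\<Sum>D\<in>Pow (insert p T). f D) = (\<Sum>D\<in>Pow T. f D) + (\<Sum>D\<in>Pow T. f (insert p D))"
proof -
  have "inj_on (insert p) (Pow T)" using assms(2) by (auto simp: inj_on_def)
  moreover have "Pow T \<inter> insert p ` Pow T = {}" using assms(2) by auto
  ultimately show ?thesis
    using assms(1) by (simp add: Pow_insert sum.union_disjoint sum.reindex)
qed

text \<open>Inclusion-exclusion, one prime at a time: the count with \<open>e\<close> accounts for
  the subsets \<open>D\<close> without \<open>p\<close>, the subtracted count with
  \<open>e * p\<close> for those with \<open>p\<close>, and the errors add up.\<close>

lemma sieve_count_discrepancy:
  fixes \<alpha> :: real
  assumes "finite T" "\<And>p. p \<in> T \<Longrightarrow> prime p" "\<And>p. p \<in> T \<Longrightarrow> coprime e p"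
    "1 \<le> e" "e * \<Prod>T dvd q" "1 \<le> q" "0 \<le> \<alpha>"
  shows "\<bar>real (sieve_count P e T \<lfloor>\<alpha> * q\<rfloor>) - \<alpha> * real (sieve_count P e T q)\<bar>
    \<le> (\<Sum>D\<in>Pow T. real (num_roots_mod P (e * \<Prod>D)))"
  using assms
proof (induction T arbitrary: e rule: finite_induct)
  case empty
  then show ?case using sieve_count_empty_discrepancy[of e q \<alpha> P] by simp
next
  case (insert p T)
  have p: "prime p" "coprime e p" using insert.prems by auto
  have p1: "1 < p" using p(1) by (simp add: prime_gt_1_int)
  have step: "real (sieve_count P e (insert p T) m) = real (sieve_count P e T m) - real (sieve_count P (e * p) T m)" for m
  proof -
    have "e * p dvd x \<longleftrightarrow> e dvd x \<and> p dvd x" for x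
      using p(2) by (metis divides_mult dvd_mult_left dvd_mult_right)
    then have "{a\<in>{1..m}. e dvd poly P a \<and> (\<forall>p\<in>T. \<not> p dvd poly P a)} =
        {a\<in>{1..m}. e dvd poly P a \<and> (\<forall>p\<in>insert p T. \<not> p dvd poly P a)} \<union>
        {a\<in>{1..m}. e * p dvd poly P a \<and> (\<forall>p\<in>T. \<not> p dvd poly P a)}" by blast
    then have "sieve_count P e T m = sieve_count P e (insert p T) m + sieve_count P (e * p) T m"
      unfolding sieve_count_def
      by (subst card_Un_disjoint[symmetric]; (intro finite_Collect_conjI disjI1)?) (auto dest: dvd_mult_right)
    then show ?thesis by simp
  qed
  have A: "\<bar>real (sieve_count P e T \<lfloor>\<alpha> * q\<rfloor>) - \<alpha> * real (sieve_count P e T q)\<bar>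
      \<le> (\<Sum>D\<in>Pow T. real (num_roots_mod P (e * \<Prod>D)))"
  proof (rule insert.IH)
    have "e * \<Prod>T dvd e * \<Prod>(insert p T)" using insert.hyps by simp
    then show "e * \<Prod>T dvd q" using insert.prems(4) dvd_trans by blast
  qed (use insert.prems in auto)
  have B: "\<bar>real (sieve_count P (e * p) T \<lfloor>\<alpha> * q\<rfloor>) - \<alpha> * real (sieve_count P (e * p) T q)\<bar>
      \<le> (\<Sum>D\<in>Pow T. real (num_roots_mod P (e * p * \<Prod>D)))"
  proof (rule insert.IH)
    show "e * p * \<Prod>T dvd q" using insert.prems(4) insert.hyps by (simp add: mult.assoc)
    show "coprime (e * p) p'" if "p' \<in> T" for p'
    proof -
      have "coprime p p'" using that insert.prems(1) insert.hyps(2) by (intro primes_coprime) auto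
      then show ?thesis using that insert.prems(2) by simp
    qed
    show "1 \<le> e * p" using insert.prems(3) p1 mult_mono[of 1 e 1 p] by simp
  qed (use insert.prems in auto)
  have C: "(\<Sum>D\<in>Pow T. real (num_roots_mod P (e * p * \<Prod>D))) = (\<Sum>D\<in>Pow T. real (num_roots_mod P (e * \<Prod>(insert p D))))"
  proof (rule sum.cong[OF refl])
    fix D assume "D \<in> Pow T"
    then have "finite D" "p \<notin> D" using insert.hyps finite_subset by auto
    then show "real (num_roots_mod P (e * p * \<Prod>D)) = real (num_roots_mod P (e * \<Prod>(insert p D)))"
      by (simp add: mult.assoc)
  qed
  show ?case
    unfolding step sum_Pow_insert[OF insert.hyps] using A B unfolding C
    by (simp add: algebra_simps)
qed

lemma prod_primes_int:
  fixes D :: "int set"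
  assumes "finite D" "\<And>p. p \<in> D \<Longrightarrow> prime p"
  shows "prime p \<Longrightarrow> p dvd \<Prod>D \<longleftrightarrow> p \<in> D" and "squarefree (\<Prod>D)" and "1 \<le> \<Prod>D"
proof -
  show *: "p dvd \<Prod>D \<longleftrightarrow> p \<in> D" if "prime p" for p
    using assms that by (metis dvd_refl prime_dvd_prod_iff primes_dvd_imp_eq)
  show "squarefree (\<Prod>D)"
    using assms by (intro squarefree_prod_coprime) (auto intro: primes_coprime squarefree_prime)
  show "1 \<le> \<Prod>D" using assms(2) by (intro prod_ge_1) (auto dest: prime_ge_1_int)
qed

text \<open>The sieve runs over all primes of \<open>q\<close>. Distinct sets of them have distinct
  squarefree products dividing \<open>q\<close>, which turns the sum over subsets into one over
  divisors.\<close>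

lemma coprime_count_discrepancy:
  fixes \<alpha> :: real
  assumes q: "1 \<le> q" and "0 \<le> \<alpha>"
  shows "\<bar>real (card {a\<in>{1..\<lfloor>\<alpha> * q\<rfloor>}. coprime (poly P a) q}) - \<alpha> * real (card {a\<in>{1..q}. coprime (poly P a) q})\<bar>
    \<le> (\<Sum>d | 1 \<le> d \<and> d dvd q \<and> squarefree d. real (num_roots_mod P d))"
proof -
  define T where "T = prime_factors q"
  have T: "finite T" "\<And>p. p \<in> T \<Longrightarrow> prime p" "\<And>p. p \<in> T \<Longrightarrow> p dvd q" by (auto simp: T_def)
  have cop: "coprime x q \<longleftrightarrow> (\<forall>p\<in>T. \<not> p dvd x)" for x :: int
  proof
    assume "coprime x q"
    then show "\<forall>p\<in>T. \<not> p dvd x" using T by (metis coprime_common_divisor not_prime_unit)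
  next
    assume *: "\<forall>p\<in>T. \<not> p dvd x"
    show "coprime x q"
    proof (rule ccontr)
      assume "\<not> coprime x q"
      then have "\<not> is_unit (gcd x q)" by (simp add: coprime_iff_gcd_eq_1)
      moreover have "gcd x q \<noteq> 0" using q by simp
      ultimately obtain p where "p dvd gcd x q" "prime p" using prime_divisor_exists by blast
      then have "prime p" "p dvd x" "p dvd q" by simp_all
      then show False using * q by (auto simp: T_def in_prime_factors_iff)
    qed
  qed
  have cnt: "card {a\<in>{1..m}. coprime (poly P a) q} = sieve_count P 1 T m" for m
    by (simp add: sieve_count_def cop)
  have dvd: "\<Prod>D dvd q" if "D \<subseteq> T" for D
  proof (rule squarefree_int_dvdI)
    have D: "finite D" "\<And>p. p \<in> D \<Longrightarrow> prime p" using that T finite_subset by auto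
    show "squarefree (\<Prod>D)" by (rule prod_primes_int(2)[OF D])
    show "p dvd q" if "prime p" "p dvd \<Prod>D" for p
      using prod_primes_int(1)[OF D that(1)] that(2) \<open>D \<subseteq> T\<close> T(3) by auto
  qed
  have inj: "inj_on (\<lambda>D. \<Prod>D) (Pow T)"
  proof (rule inj_onI)
    fix D E assume *: "D \<in> Pow T" "E \<in> Pow T" "\<Prod>D = \<Prod>E"
    have D: "finite D" "\<And>p. p \<in> D \<Longrightarrow> prime p" and E: "finite E" "\<And>p. p \<in> E \<Longrightarrow> prime p"
      using * T finite_subset by auto
    show "D = E"
    proof (rule subset_antisym; rule subsetI)
      show "p \<in> E" if "p \<in> D" for p
        using prod_primes_int(1)[OF D, of p] prod_primes_int(1)[OF E, of p] *(3) D(2)[OF that] that by simp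
      show "p \<in> D" if "p \<in> E" for p
        using prod_primes_int(1)[OF D, of p] prod_primes_int(1)[OF E, of p] *(3) E(2)[OF that] that by simp
    qed
  qed
  have "\<bar>real (sieve_count P 1 T \<lfloor>\<alpha> * q\<rfloor>) - \<alpha> * real (sieve_count P 1 T q)\<bar>
      \<le> (\<Sum>D\<in>Pow T. real (num_roots_mod P (1 * \<Prod>D)))"
    by (rule sieve_count_discrepancy) (use T dvd[of T] assms in auto)
  also have "\<dots> = (\<Sum>d\<in>(\<lambda>D. \<Prod>D) ` Pow T. real (num_roots_mod P d))"
    by (simp add: sum.reindex[OF inj])
  also have "\<dots> \<le> (\<Sum>d | 1 \<le> d \<and> d dvd q \<and> squarefree d. real (num_roots_mod P d))"
  proof (rule sum_mono2)
    show "finite {d. 1 \<le> d \<and> d dvd q \<and> squarefree d}"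
      by (rule finite_subset[of _ "{1..q}"]) (use q zdvd_imp_le[of _ q] in auto)
    show "(\<lambda>D. \<Prod>D) ` Pow T \<subseteq> {d. 1 \<le> d \<and> d dvd q \<and> squarefree d}"
    proof (rule image_subsetI)
      fix D assume "D \<in> Pow T"
      then have D: "D \<subseteq> T" "finite D" "\<And>p. p \<in> D \<Longrightarrow> prime p" using T finite_subset by auto
      show "\<Prod>D \<in> {d. 1 \<le> d \<and> d dvd q \<and> squarefree d}"
        using dvd[OF D(1)] prod_primes_int(2,3)[OF D(2,3)] by simp
    qed
  qed simp
  finally show ?thesis unfolding cnt .
qed

lemma card_multiples_le:
  fixes d Q :: int
  assumes "1 \<le> d" "0 \<le> Q"
  shows "real (card {q\<in>{1..Q}. d dvd q}) \<le> real_of_int Q / real_of_int d"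
proof -
  have "{q\<in>{1..Q}. d dvd q} \<subseteq> (\<lambda>k. d * k) ` {1..Q div d}"
  proof
    fix q assume q: "q \<in> {q\<in>{1..Q}. d dvd q}"
    then obtain k where k: "q = d * k" by auto
    have "1 \<le> k" using q k assms(1) by (smt (verit) atLeastAtMost_iff mem_Collect_eq mult_le_0_iff)
    moreover have "k \<le> Q div d" using q k assms(1) zdiv_mono1[of q Q d] by simp
    ultimately show "q \<in> (\<lambda>k. d * k) ` {1..Q div d}" using k by auto
  qed
  then have "card {q\<in>{1..Q}. d dvd q} \<le> card {1..Q div d}" by (rule surj_card_le[OF finite_atLeastAtMost_int])
  moreover have "0 \<le> Q div d" using assms by (simp add: pos_imp_zdiv_nonneg_iff)
  ultimately have "real (card {q\<in>{1..Q}. d dvd q}) \<le> real_of_int (Q div d)" by simp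
  also have "\<dots> \<le> real_of_int Q / real_of_int d" by (rule real_of_int_div4)
  finally show ?thesis .
qed

lemma root_sum_altdef:
  "root_sum P Q = (\<Sum>d | 1 \<le> d \<and> d \<le> Q \<and> squarefree d. real (num_roots_mod P d) / real_of_int d)"
proof -
  have fin: "finite {d. 1 \<le> d \<and> d \<le> Q \<and> squarefree d}" by (rule finite_subset[of _ "{1..Q}"]) auto
  have fin': "finite {r. 0 \<le> r \<and> r < d \<and> d dvd poly P r}" for d
    by (rule finite_subset[of _ "{0..d}"]) auto
  have "root_pairs P Q = Sigma {d. 1 \<le> d \<and> d \<le> Q \<and> squarefree d} (\<lambda>d. {r. 0 \<le> r \<and> r < d \<and> d dvd poly P r})"
    by (auto simp: root_pairs_def)
  then have "root_sum P Q = (\<Sum>d | 1 \<le> d \<and> d \<le> Q \<and> squarefree d. \<Sum>r | 0 \<le> r \<and> r < d \<and> d dvd poly P r. 1 / real_of_int d)"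
    unfolding root_sum_def using fin fin' by (subst sum.Sigma) auto
  then show ?thesis by (simp add: num_roots_mod_def)
qed

text \<open>After exchanging the sums each \<open>d\<close> occurs for at most \<open>Q / d\<close>
  denominators, which produces the weight \<open>1 / d\<close> of \<open>root_sum\<close>.\<close>

lemma total_discrepancy:
  fixes \<alpha> :: real
  assumes "1 \<le> Q" "0 \<le> \<alpha>"
  shows "\<bar>(\<Sum>q=1..Q. real (card {a\<in>{1..\<lfloor>\<alpha> * q\<rfloor>}. coprime (poly P a) q})) -
      \<alpha> * (\<Sum>q=1..Q. real (card {a\<in>{1..q}. coprime (poly P a) q}))\<bar> \<le> real_of_int Q * root_sum P Q"
proof -
  let ?D = "{d. 1 \<le> d \<and> d \<le> Q \<and> squarefree d}"
  have fin: "finite ?D" by (rule finite_subset[of _ "{1..Q}"]) auto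
  have "\<bar>(\<Sum>q=1..Q. real (card {a\<in>{1..\<lfloor>\<alpha> * q\<rfloor>}. coprime (poly P a) q})) -
      \<alpha> * (\<Sum>q=1..Q. real (card {a\<in>{1..q}. coprime (poly P a) q}))\<bar>
    = \<bar>\<Sum>q=1..Q. real (card {a\<in>{1..\<lfloor>\<alpha> * q\<rfloor>}. coprime (poly P a) q}) - \<alpha> * real (card {a\<in>{1..q}. coprime (poly P a) q})\<bar>"
    by (simp add: sum_subtractf sum_distrib_left)
  also have "\<dots> \<le> (\<Sum>q=1..Q. \<bar>real (card {a\<in>{1..\<lfloor>\<alpha> * q\<rfloor>}. coprime (poly P a) q}) - \<alpha> * real (card {a\<in>{1..q}. coprime (poly P a) q})\<bar>)"
    by (rule sum_abs)
  also have "\<dots> \<le> (\<Sum>q=1..Q. \<Sum>d | 1 \<le> d \<and> d dvd q \<and> squarefree d. real (num_roots_mod P d))"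
    using assms(2) by (intro sum_mono coprime_count_discrepancy) auto
  also have "\<dots> = (\<Sum>q=1..Q. \<Sum>d | d \<in> ?D \<and> d dvd q. real (num_roots_mod P d))"
  proof (intro sum.cong refl)
    fix q assume "q \<in> {1..Q}"
    then have "d \<le> Q" if "d dvd q" for d using that zdvd_imp_le[of d q] by auto
    then show "{d. 1 \<le> d \<and> d dvd q \<and> squarefree d} = {d. d \<in> ?D \<and> d dvd q}" by auto
  qed
  also have "\<dots> = (\<Sum>d\<in>?D. \<Sum>q | q \<in> {1..Q} \<and> d dvd q. real (num_roots_mod P d))"
    by (rule sum.swap_restrict[OF _ fin]) simp
  also have "\<dots> = (\<Sum>d\<in>?D. real (card {q\<in>{1..Q}. d dvd q}) * real (num_roots_mod P d))" by simp
  also have "\<dots> \<le> (\<Sum>d\<in>?D. (real_of_int Q / real_of_int d) * real (num_roots_mod P d))"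
    using assms(1) by (intro sum_mono mult_right_mono card_multiples_le) auto
  also have "\<dots> = real_of_int Q * root_sum P Q"
    by (simp add: root_sum_altdef sum_distrib_left)
  finally show ?thesis .
qed

section \<open>Sieving the denominators\<close>

text \<open>Lagrange's argument: splitting off \<open>[:- r, 1:]\<close> at a root \<open>r\<close>
  keeps the leading coefficient and lowers the degree, and as \<open>p\<close> is prime, every other
  root is a root of the quotient.\<close>

lemma num_roots_mod_prime_le:
  assumes "prime p" "\<not> p dvd lead_coeff P"
  shows "num_roots_mod P p \<le> degree P"
  using assms(2)
proof (induction "degree P" arbitrary: P)
  case 0
  then obtain c where c: "P = [:c:]" by (metis degree_eq_zeroE)
  then have none: "{r. 0 \<le> r \<and> r < p \<and> p dvd poly P r} = {}" using 0 by auto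
  show ?case unfolding num_roots_mod_def none by simp
next
  case (Suc m)
  show ?case
  proof (cases "\<exists>r. 0 \<le> r \<and> r < p \<and> p dvd poly P r")
    case False
    then have none: "{r. 0 \<le> r \<and> r < p \<and> p dvd poly P r} = {}" by auto
    show ?thesis unfolding num_roots_mod_def none by simp
  next
    case True
    then obtain r where r: "0 \<le> r" "r < p" "p dvd poly P r" by auto
    define S where "S = synthetic_div P r"
    have P: "P = [:- r, 1:] * S + [:poly P r:]" unfolding S_def by (rule synthetic_div_correct'[symmetric])
    have degS: "degree S = m" using Suc(2) by (simp add: S_def degree_synthetic_div)
    have "coeff P (Suc m) = coeff S m"
      using arg_cong[OF P, of "\<lambda>q. coeff q (Suc m)"] degS by (simp add: coeff_eq_0)
    then have "\<not> p dvd lead_coeff S" using Suc(2,3) degS by simp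
    then have IH: "num_roots_mod S p \<le> m" using Suc(1)[of S] degS by simp
    have "{s. 0 \<le> s \<and> s < p \<and> p dvd poly P s} \<subseteq> insert r {s. 0 \<le> s \<and> s < p \<and> p dvd poly S s}"
    proof
      fix s assume s: "s \<in> {s. 0 \<le> s \<and> s < p \<and> p dvd poly P s}"
      have "poly P s = (s - r) * poly S s + poly P r" by (subst P) (simp add: algebra_simps)
      then have "p dvd (s - r) * poly S s" using s r(3) by (metis (mono_tags, lifting) dvd_add_left_iff mem_Collect_eq)
      then have "p dvd s - r \<or> p dvd poly S s" using assms(1) by (simp add: prime_dvd_mult_iff)
      moreover have "s = r" if "p dvd s - r"
      proof -
        have "s mod p = r mod p" using that by (simp add: mod_eq_dvd_iff)
        then show ?thesis using s r by simp
      qed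
      ultimately show "s \<in> insert r {s. 0 \<le> s \<and> s < p \<and> p dvd poly S s}" using s by auto
    qed
    moreover have fin: "finite {s. 0 \<le> s \<and> s < p \<and> p dvd poly S s}"
      by (rule finite_subset[of _ "{0..p}"]) auto
    ultimately have "num_roots_mod P p \<le> card (insert r {s. 0 \<le> s \<and> s < p \<and> p dvd poly S s})"
      unfolding num_roots_mod_def by (intro card_mono) auto
    also have "\<dots> \<le> Suc (num_roots_mod S p)"
      unfolding num_roots_mod_def using fin by (simp add: card_insert_if)
    finally show ?thesis using IH Suc(2) by simp
  qed
qed

text \<open>Telescoping, by \<open>1 / (x + 1)\<^sup>2 \<le> 1 / x - 1 / (x + 1)\<close>.\<close>

lemma sum_inverse_squares_le:
  fixes K :: int
  assumes "1 \<le> K"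
  shows "(\<Sum>m\<in>{K<..Q}. 1 / (real_of_int m)\<^sup>2) \<le> 1 / real_of_int K"
proof -
  have *: "(\<Sum>m\<in>{K<..K + int j}. 1 / (real_of_int m)\<^sup>2) \<le> 1 / real_of_int K - 1 / real_of_int (K + int j)" for j
  proof (induction j)
    case (Suc j)
    define x where "x = real_of_int (K + int j)"
    have x: "1 \<le> x" using assms by (simp add: x_def)
    have "{K<..K + int (Suc j)} = insert (K + int (Suc j)) {K<..K + int j}" by auto
    then have "(\<Sum>m\<in>{K<..K + int (Suc j)}. 1 / (real_of_int m)\<^sup>2) =
        1 / (x + 1)\<^sup>2 + (\<Sum>m\<in>{K<..K + int j}. 1 / (real_of_int m)\<^sup>2)" by (simp add: x_def add_ac)
    also have "\<dots> \<le> 1 / (x + 1)\<^sup>2 + (1 / real_of_int K - 1 / x)" using Suc by (simp add: x_def)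
    also have "1 / (x + 1)\<^sup>2 \<le> 1 / x - 1 / (x + 1)"
    proof -
      have "1 / (x + 1)\<^sup>2 \<le> 1 / (x * (x + 1))"
        using x by (intro divide_left_mono) (auto simp: power2_eq_square)
      also have "\<dots> = 1 / x - 1 / (x + 1)" using x by (simp add: field_simps)
      finally show ?thesis .
    qed
    finally show ?case by (simp add: x_def add_ac)
  qed simp
  show ?thesis
  proof (cases "K \<le> Q")
    case True
    then have "Q = K + int (nat (Q - K))" by simp
    with *[of "nat (Q - K)"] have "(\<Sum>m\<in>{K<..Q}. 1 / (real_of_int m)\<^sup>2) \<le> 1 / real_of_int K - 1 / real_of_int Q" by simp
    moreover have "0 \<le> 1 / real_of_int Q" using True assms by simp
    ultimately show ?thesis by linarith
  next
    case False
    then show ?thesis using assms by simp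
  qed
qed

text \<open>Terms up to \<open>K\<close> are bounded by 1 and later ones by \<open>1 / K\<close>.
  For a large fixed \<open>K\<close> this is a small multiple of \<open>Q\<close> plus a constant,
  so no logarithm is involved.\<close>

lemma sum_inverse_le:
  fixes K Q :: int
  assumes "1 \<le> K" "0 \<le> Q"
  shows "(\<Sum>m=1..Q. 1 / real_of_int m) \<le> real_of_int K + real_of_int Q / real_of_int K"
proof -
  have "(\<Sum>m=1..Q. 1 / real_of_int m) \<le> (\<Sum>m=1..Q. (if m \<le> K then 1 else 0) + 1 / real_of_int K)"
  proof (rule sum_mono)
    fix m assume m: "m \<in> {1..Q}"
    show "1 / real_of_int m \<le> (if m \<le> K then 1 else 0) + 1 / real_of_int K"
    proof (cases "m \<le> K")
      case True
      have "1 / real_of_int m \<le> 1" "0 \<le> 1 / real_of_int K" using m assms by simp_all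
      then have "1 / real_of_int m \<le> 1 + 1 / real_of_int K" by linarith
      then show ?thesis using True by simp
    next
      case False
      then show ?thesis using assms by (simp add: frac_le)
    qed
  qed
  also have "\<dots> = real (card {m\<in>{1..Q}. m \<le> K}) + real_of_int Q / real_of_int K"
    using assms by (simp add: sum.distrib sum.inter_filter[symmetric])
  also have "card {m\<in>{1..Q}. m \<le> K} \<le> card {1..K}" by (intro card_mono) auto
  finally show ?thesis using assms by simp
qed

text \<open>The admissible \<open>k\<close> all lie in one residue class modulo \<open>p\<close>, so
  \<open>k div p\<close> determines \<open>k\<close>.\<close>

lemma card_dvd_progression_le:
  fixes p M X :: int
  assumes "1 \<le> p" "coprime p M" "0 \<le> X"
  shows "real (card {k\<in>{0..X}. p dvd 1 + M * k}) \<le> real_of_int X / real_of_int p + 1"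
proof -
  have "inj_on (\<lambda>k. k div p) {k\<in>{0..X}. p dvd 1 + M * k}"
  proof (rule inj_onI)
    fix k l assume *: "k \<in> {k\<in>{0..X}. p dvd 1 + M * k}" "l \<in> {k\<in>{0..X}. p dvd 1 + M * k}" "k div p = l div p"
    then have "p dvd (1 + M * k) - (1 + M * l)" by (intro dvd_diff) auto
    then have "p dvd M * (k - l)" by (simp add: algebra_simps)
    then have "p dvd k - l" using assms(2) by (simp add: coprime_dvd_mult_right_iff)
    then have "k mod p = l mod p" by (simp add: mod_eq_dvd_iff)
    with *(3) show "k = l" by (metis div_mult_mod_eq)
  qed
  moreover have "(\<lambda>k. k div p) ` {k\<in>{0..X}. p dvd 1 + M * k} \<subseteq> {0..X div p}"
    using assms(1) by (auto simp: pos_imp_zdiv_nonneg_iff zdiv_mono1)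
  ultimately have "card {k\<in>{0..X}. p dvd 1 + M * k} \<le> card {0..X div p}" by (intro card_inj_on_le) auto
  moreover have "0 \<le> X div p" using assms by (simp add: pos_imp_zdiv_nonneg_iff)
  ultimately have "real (card {k\<in>{0..X}. p dvd 1 + M * k}) \<le> real_of_int (X div p) + 1" by simp
  also have "real_of_int (X div p) \<le> real_of_int X / real_of_int p" by (rule real_of_int_div4)
  finally show ?thesis by simp
qed

text \<open>A union bound: each prime \<open>p\<close> of \<open>q\<close> excludes the
  \<open>a\<close> at which \<open>p\<close> divides the value of \<open>P\<close>, and these fill
  at most \<open>degree P\<close> places in each of \<open>q / p\<close> blocks.\<close>

lemma coprime_count_ge:
  assumes q: "1 \<le> q" and lc: "\<And>p. prime p \<Longrightarrow> p dvd q \<Longrightarrow> \<not> p dvd lead_coeff P"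
  shows "real_of_int q - real (degree P) * real_of_int q * (\<Sum>p\<in>prime_factors q. 1 / real_of_int p)
    \<le> real (card {a\<in>{1..q}. coprime (poly P a) q})"
proof -
  define B where "B = (\<lambda>p. {a\<in>{1..q}. p dvd poly P a})"
  have finB: "finite (B p)" for p unfolding B_def by (rule finite_subset[of _ "{1..q}"]) auto
  have sub: "{1..q} \<subseteq> {a\<in>{1..q}. coprime (poly P a) q} \<union> (\<Union>p\<in>prime_factors q. B p)"
  proof
    fix a assume a: "a \<in> {1..q}"
    show "a \<in> {a\<in>{1..q}. coprime (poly P a) q} \<union> (\<Union>p\<in>prime_factors q. B p)"
    proof (cases "coprime (poly P a) q")
      case False
      then have "\<not> is_unit (gcd (poly P a) q)" by (simp add: coprime_iff_gcd_eq_1)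
      moreover have "gcd (poly P a) q \<noteq> 0" using q by simp
      ultimately obtain p where "p dvd gcd (poly P a) q" "prime p" using prime_divisor_exists by blast
      then have "p \<in> prime_factors q" "a \<in> B p" using a q by (auto simp: B_def in_prime_factors_iff)
      then show ?thesis by blast
    qed (use a in auto)
  qed
  have fin1: "finite {a\<in>{1..q}. coprime (poly P a) q}" by (rule finite_subset[of _ "{1..q}"]) auto
  have cardB: "real (card (B p)) \<le> real (degree P) * real_of_int q * (1 / real_of_int p)"
    if "p \<in> prime_factors q" for p
  proof -
    have p: "prime p" "p dvd q" using that by auto
    have p1: "1 \<le> p" using p(1) by (simp add: prime_ge_1_int)
    obtain u where u: "q = p * u" using p(2) by blast
    have "0 \<le> u" using u q p1 by (smt (verit) mult_le_0_iff)
    then obtain t where t: "q = int t * p" using u by (metis mult.commute nonneg_int_cases)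
    have "card (B p) = t * num_roots_mod P p"
      using sieve_count_empty_multiple[OF p1, of P t] by (simp add: B_def sieve_count_def t)
    also have "\<dots> \<le> t * degree P" using num_roots_mod_prime_le[OF p(1) lc[OF p]] by simp
    finally have "real (card (B p)) \<le> real (t * degree P)" by (simp only: of_nat_le_iff)
    also have "\<dots> = real (degree P) * real_of_int q * (1 / real_of_int p)" using p1 by (simp add: t)
    finally show ?thesis .
  qed
  have "card {1..q} \<le> card ({a\<in>{1..q}. coprime (poly P a) q} \<union> (\<Union>p\<in>prime_factors q. B p))"
    using fin1 finB by (intro card_mono sub) auto
  also have "\<dots> \<le> card {a\<in>{1..q}. coprime (poly P a) q} + card (\<Union>p\<in>prime_factors q. B p)"
    by (rule card_Un_le)
  also have "card (\<Union>p\<in>prime_factors q. B p) \<le> (\<Sum>p\<in>prime_factors q. card (B p))"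
    by (rule card_UN_le) simp
  finally have "nat q \<le> card {a\<in>{1..q}. coprime (poly P a) q} + (\<Sum>p\<in>prime_factors q. card (B p))" by simp
  then have "real (nat q) \<le> real (card {a\<in>{1..q}. coprime (poly P a) q} + (\<Sum>p\<in>prime_factors q. card (B p)))"
    by (simp only: of_nat_le_iff)
  then have "real_of_int q \<le> real (card {a\<in>{1..q}. coprime (poly P a) q}) + (\<Sum>p\<in>prime_factors q. real (card (B p)))"
    using q by simp
  also have "(\<Sum>p\<in>prime_factors q. real (card (B p))) \<le> (\<Sum>p\<in>prime_factors q. real (degree P) * real_of_int q * (1 / real_of_int p))"
    by (intro sum_mono cardB)
  finally show ?thesis by (simp add: sum_distrib_left)
qed

text \<open>Only denominators \<open>1 + M * k\<close> are counted. Their prime factors are large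
  and avoid the leading coefficient, so on average over \<open>k\<close> the sum of
  \<open>1 / p\<close> is too small for the union bound to consume the main term.\<close>

lemma coprime_pairs_lower_bound:
  assumes "P \<noteq> 0"
  shows "\<exists>c>0. \<forall>Q::int. 1 \<le> Q \<longrightarrow>
    c * (real_of_int Q)\<^sup>2 \<le> (\<Sum>q=1..Q. real (card {a\<in>{1..q}. coprime (poly P a) q}))"
proof -
  define n where "n = int (degree P) + 1"
  \<comment> \<open>The constants divide up the main term \<open>Q\<^sup>2 / (2 * M)\<close>:
    \<open>K\<close> limits one loss to half of it, \<open>L\<close> another to
    \<open>Q\<^sup>2 / (16 * M)\<close>, and \<open>Q0\<close> the lower-order terms to
    \<open>Q\<^sup>2 / (8 * M)\<close>, which leaves \<open>Q\<^sup>2 / (16 * M)\<close>.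
    \<open>M\<close> is a multiple of the leading coefficient and of all primes up to
    \<open>K\<close>.\<close>
  define K where "K = 4 * n"
  define M where "M = \<bar>lead_coeff P\<bar> * fact (nat K)"
  define L where "L = 16 * n * M"
  define Q0 where "Q0 = 8 * real_of_int M * (1 + 16 * (real_of_int n)\<^sup>2 * real_of_int M)"
  have n1: "1 \<le> n" by (simp add: n_def)
  have K1: "1 \<le> K" using n1 by (simp add: K_def)
  have "0 < \<bar>lead_coeff P\<bar>" using assms by simp
  then have "0 < M" unfolding M_def by (intro mult_pos_pos) auto
  then have M1: "1 \<le> M" by simp
  have L1: "1 \<le> L" using mult_mono[OF n1 M1] n1 by (simp add: L_def)
  have Q0pos: "0 < Q0" using M1 by (simp add: Q0_def add_pos_nonneg)
  let ?good = "\<lambda>q. real (card {a\<in>{1..q}. coprime (poly P a) q})"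
  have large: "(real_of_int Q)\<^sup>2 / (16 * real_of_int M) \<le> (\<Sum>q=1..Q. ?good q)"
    if Q: "1 \<le> Q" "Q0 \<le> real_of_int Q" for Q :: int
  proof -
    define X where "X = (Q - 1) div M"
    have X0: "0 \<le> X" using Q M1 by (simp add: X_def pos_imp_zdiv_nonneg_iff)
    have MX: "M * X \<le> Q - 1" "Q \<le> M * (X + 1)"
    proof -
      have "Q - 1 = M * X + (Q - 1) mod M" by (simp add: X_def)
      moreover have "0 \<le> (Q - 1) mod M" "(Q - 1) mod M < M" using M1 by simp_all
      ultimately show "M * X \<le> Q - 1" "Q \<le> M * (X + 1)" by (auto simp: algebra_simps)
    qed
    define f where "f = (\<lambda>k. 1 + M * k)"
    have f: "1 \<le> f k" "f k \<le> Q" if "k \<in> {0..X}" for k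
    proof -
      have "0 \<le> M * k" "M * k \<le> M * X" using that M1 by (auto intro: mult_left_mono)
      then show "1 \<le> f k" "f k \<le> Q" using MX(1) by (auto simp: f_def)
    qed
    have injf: "inj_on f {0..X}" using M1 by (auto simp: inj_on_def f_def)
    have cop: "coprime p M" if "p dvd f k" for p k
    proof (rule coprimeI)
      fix c assume "c dvd p" "c dvd M"
      then have "c dvd f k - M * k" using that by (intro dvd_diff) (auto intro: dvd_trans)
      then show "is_unit c" by (simp add: f_def)
    qed
    have big: "K < p \<and> \<not> p dvd lead_coeff P" if "prime p" "p dvd f k" for p k
    proof -
      have nd: "\<not> p dvd M" using cop[OF that(2)] that(1) by (metis coprime_common_divisor dvd_refl not_prime_unit)
      then have "\<not> p dvd lead_coeff P" by (auto simp: M_def)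
      moreover have "K < p"
      proof (rule ccontr)
        assume "\<not> K < p"
        moreover have "1 < p" using that(1) by (simp add: prime_gt_1_int)
        ultimately have "nat p dvd fact (nat K)" by (intro dvd_fact) auto
        then have "int (nat p) dvd int (fact (nat K))" by (simp only: int_dvd_int_iff)
        then have "p dvd fact (nat K)" using \<open>1 < p\<close> by (simp add: of_nat_fact)
        then show False using nd by (simp add: M_def)
      qed
      ultimately show ?thesis by blast
    qed
    define Pr where "Pr = {p. prime p \<and> K < p \<and> p \<le> Q \<and> coprime p M}"
    have finPr: "finite Pr" by (rule finite_subset[of _ "{K..Q}"]) (auto simp: Pr_def)
    have pf: "prime_factors (f k) = {p \<in> Pr. p dvd f k}" if "k \<in> {0..X}" for k
    proof -
      have "p \<le> Q" if "p dvd f k" for p using zdvd_imp_le[OF that] f[OF \<open>k \<in> {0..X}\<close>] by simp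
      then show ?thesis
        using f(1)[OF that] big cop by (auto simp: Pr_def in_prime_factors_iff)
    qed
    define \<sigma> where "\<sigma> = (\<Sum>k=0..X. \<Sum>p\<in>prime_factors (f k). 1 / real_of_int p)"
    have \<sigma>: "\<sigma> \<le> real_of_int X / real_of_int K + (real_of_int L + real_of_int Q / real_of_int L)"
    proof -
      have "\<sigma> = (\<Sum>k\<in>{0..X}. \<Sum>p | p \<in> Pr \<and> p dvd f k. 1 / real_of_int p)"
        unfolding \<sigma>_def by (intro sum.cong refl pf)
      also have "\<dots> = (\<Sum>p\<in>Pr. \<Sum>k | k \<in> {0..X} \<and> p dvd f k. 1 / real_of_int p)"
        by (rule sum.swap_restrict[OF _ finPr]) simp
      also have "\<dots> = (\<Sum>p\<in>Pr. real (card {k\<in>{0..X}. p dvd 1 + M * k}) * (1 / real_of_int p))"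
        by (simp add: f_def)
      also have "\<dots> \<le> (\<Sum>p\<in>Pr. (real_of_int X / real_of_int p + 1) * (1 / real_of_int p))"
        using X0 K1 by (intro sum_mono mult_right_mono card_dvd_progression_le) (auto simp: Pr_def)
      also have "\<dots> = real_of_int X * (\<Sum>p\<in>Pr. 1 / (real_of_int p)\<^sup>2) + (\<Sum>p\<in>Pr. 1 / real_of_int p)"
        by (simp add: algebra_simps sum.distrib sum_distrib_left power2_eq_square)
      \<comment> \<open>Both sums over primes are enlarged to sums over integers; the second need
        only be a small multiple of \<open>Q\<close> up to a constant.\<close>
      also have "\<dots> \<le> real_of_int X * (\<Sum>m\<in>{K<..Q}. 1 / (real_of_int m)\<^sup>2) + (\<Sum>m=1..Q. 1 / real_of_int m)"
        using X0 K1 by (intro add_mono mult_left_mono sum_mono2) (auto simp: Pr_def)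
      also have "\<dots> \<le> real_of_int X * (1 / real_of_int K) + (real_of_int L + real_of_int Q / real_of_int L)"
        using X0 K1 L1 Q(1) by (intro add_mono mult_left_mono sum_inverse_squares_le sum_inverse_le) auto
      finally show ?thesis by simp
    qed
    have good: "real_of_int (f k) - real_of_int n * real_of_int Q * (\<Sum>p\<in>prime_factors (f k). 1 / real_of_int p) \<le> ?good (f k)"
      if "k \<in> {0..X}" for k
    proof -
      have s0: "0 \<le> (\<Sum>p\<in>prime_factors (f k). 1 / real_of_int p)"
        by (intro sum_nonneg) (auto simp: prime_ge_0_int)
      have "real (degree P) * real_of_int (f k) * (\<Sum>p\<in>prime_factors (f k). 1 / real_of_int p)
          \<le> real_of_int n * real_of_int Q * (\<Sum>p\<in>prime_factors (f k). 1 / real_of_int p)"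
        using f[OF that] Q s0 by (intro mult_right_mono[OF _ s0] mult_mono) (auto simp: n_def)
      moreover have "real_of_int (f k) - real (degree P) * real_of_int (f k) * (\<Sum>p\<in>prime_factors (f k). 1 / real_of_int p) \<le> ?good (f k)"
        using f(1)[OF that] big by (intro coprime_count_ge) auto
      ultimately show ?thesis by linarith
    qed
    \<comment> \<open>The triangular sum gives \<open>M * (X + 1) * X / 2\<close>, and
      \<open>M * (X + 1) \<ge> Q\<close>.\<close>
    have lin: "(\<Sum>k=0..X. real_of_int (f k)) \<ge> real_of_int Q * real_of_int X / 2"
    proof -
      have tri: "2 * (\<Sum>k=0..int j. k) = int j * (int j + 1)" for j
      proof (induction j)
        case (Suc j)
        have "{0..int (Suc j)} = insert (int (Suc j)) {0..int j}" by auto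
        then show ?case using Suc by (simp add: algebra_simps)
      qed simp
      have "(\<Sum>k=0..X. f k) = (X + 1) + M * (\<Sum>k=0..X. k)"
        using X0 by (simp add: f_def sum.distrib sum_distrib_left)
      then have "2 * (\<Sum>k=0..X. f k) = 2 * (X + 1) + M * (2 * (\<Sum>k=0..X. k))" by simp
      also have "\<dots> = 2 * (X + 1) + M * (X + 1) * X"
        using tri[of "nat X"] X0 by (simp add: algebra_simps)
      also have "\<dots> \<ge> Q * X" using mult_right_mono[OF MX(2) X0] X0 by simp
      finally have "real_of_int (Q * X) \<le> real_of_int (2 * (\<Sum>k=0..X. f k))" by (simp only: of_int_le_iff)
      then show ?thesis by simp
    qed
    define x where "x = real_of_int Q"
    define m where "m = real_of_int M"
    define u where "u = real_of_int n"
    have pos: "1 \<le> x" "1 \<le> m" "1 \<le> u" using Q M1 n1 by (simp_all add: x_def m_def u_def)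
    have Xm: "real_of_int X \<le> x / m" "x / m - 1 \<le> real_of_int X"
    proof -
      have "real_of_int (M * X) \<le> real_of_int Q" using MX(1) by (simp only: of_int_le_iff)
      then show "real_of_int X \<le> x / m" using pos by (simp add: x_def m_def field_simps)
      have "real_of_int Q \<le> real_of_int (M * (X + 1))" using MX(2) by (simp only: of_int_le_iff)
      then show "x / m - 1 \<le> real_of_int X" using pos by (simp add: x_def m_def field_simps)
    qed
    have "(\<Sum>k=0..X. real_of_int (f k)) - u * x * \<sigma> =
        (\<Sum>k=0..X. real_of_int (f k) - u * x * (\<Sum>p\<in>prime_factors (f k). 1 / real_of_int p))"
      by (simp add: sum_subtractf sum_distrib_left \<sigma>_def)
    also have "\<dots> \<le> (\<Sum>k=0..X. ?good (f k))"
      unfolding u_def x_def by (intro sum_mono good) auto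
    also have "\<dots> = (\<Sum>q\<in>f ` {0..X}. ?good q)" by (simp add: sum.reindex[OF injf])
    also have "\<dots> \<le> (\<Sum>q=1..Q. ?good q)" using f by (intro sum_mono2) auto
    finally have main: "(\<Sum>q=1..Q. ?good q) \<ge> (\<Sum>k=0..X. real_of_int (f k)) - u * x * \<sigma>" .
    have "u * x * \<sigma> \<le> u * x * ((x / m) / (4 * u) + (16 * u * m + x / (16 * u * m)))"
    proof (rule mult_left_mono)
      have "real_of_int X / (4 * u) \<le> (x / m) / (4 * u)" using Xm(1) pos by (intro divide_right_mono) auto
      moreover have "\<sigma> \<le> real_of_int X / (4 * u) + (16 * u * m + x / (16 * u * m))"
        using \<sigma> unfolding K_def L_def u_def m_def x_def by (simp only: of_int_mult of_int_numeral)
      ultimately show "\<sigma> \<le> (x / m) / (4 * u) + (16 * u * m + x / (16 * u * m))" by linarith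
    qed (use pos in auto)
    also have "\<dots> = x\<^sup>2 / (4 * m) + 16 * u\<^sup>2 * m * x + x\<^sup>2 / (16 * m)"
      using pos by (simp add: field_simps power2_eq_square)
    finally have "u * x * \<sigma> \<le> x\<^sup>2 / (4 * m) + 16 * u\<^sup>2 * m * x + x\<^sup>2 / (16 * m)" .
    moreover have "(\<Sum>k=0..X. real_of_int (f k)) \<ge> x\<^sup>2 / (2 * m) - x / 2"
    proof -
      have "x * (x / m - 1) \<le> x * real_of_int X" using Xm(2) pos by (intro mult_left_mono) auto
      moreover have "x\<^sup>2 / (2 * m) - x / 2 = x * (x / m - 1) / 2"
        by (simp add: power2_eq_square algebra_simps)
      ultimately show ?thesis using lin by (simp add: x_def)
    qed
    moreover have "x\<^sup>2 / (8 * m) \<ge> x / 2 + 16 * u\<^sup>2 * m * x"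
    proof -
      have "x / 2 + 16 * u\<^sup>2 * m * x \<le> x * (1 + 16 * u\<^sup>2 * m)" using pos by (simp add: algebra_simps)
      also have "1 + 16 * u\<^sup>2 * m \<le> x / (8 * m)"
        using Q(2) pos by (simp add: Q0_def u_def m_def x_def field_simps)
      also have "x * (x / (8 * m)) = x\<^sup>2 / (8 * m)" by (simp add: power2_eq_square)
      finally show ?thesis using pos by simp
    qed
    moreover have "x\<^sup>2 / (2 * m) - x\<^sup>2 / (4 * m) - x\<^sup>2 / (16 * m) - x\<^sup>2 / (8 * m) = x\<^sup>2 / (16 * m)"
      using pos by (simp add: field_simps)
    ultimately have "(\<Sum>q=1..Q. ?good q) \<ge> x\<^sup>2 / (16 * m)" using main by linarith
    then show ?thesis by (simp add: x_def m_def)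
  qed
  have one: "1 \<le> (\<Sum>q=1..Q. ?good q)" if "1 \<le> Q" for Q :: int
  proof -
    have "{a\<in>{1..1}. coprime (poly P a) 1} = {1}" by auto
    then have "?good 1 = 1" by simp
    moreover have "?good 1 \<le> (\<Sum>q=1..Q. ?good q)" using that by (intro member_le_sum) auto
    ultimately show ?thesis by linarith
  qed
  show ?thesis
  \<comment> \<open>The second entry of the minimum covers \<open>Q < Q0\<close>: there the sum is
    at least 1, from the denominator 1 alone, while
    \<open>Q\<^sup>2 \<le> Q0\<^sup>2\<close>.\<close>
  proof (intro exI[of _ "min (1 / (16 * real_of_int M)) (1 / Q0\<^sup>2)"] conjI allI impI)
    show "0 < min (1 / (16 * real_of_int M)) (1 / Q0\<^sup>2)" using M1 Q0pos by simp
    fix Q :: int assume Q: "1 \<le> Q"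
    show "min (1 / (16 * real_of_int M)) (1 / Q0\<^sup>2) * (real_of_int Q)\<^sup>2 \<le> (\<Sum>q=1..Q. ?good q)"
    proof (cases "Q0 \<le> real_of_int Q")
      case True
      have "min (1 / (16 * real_of_int M)) (1 / Q0\<^sup>2) * (real_of_int Q)\<^sup>2 \<le> 1 / (16 * real_of_int M) * (real_of_int Q)\<^sup>2"
        by (intro mult_right_mono) auto
      with large[OF Q True] show ?thesis by simp
    next
      case False
      have "min (1 / (16 * real_of_int M)) (1 / Q0\<^sup>2) * (real_of_int Q)\<^sup>2 \<le> 1 / Q0\<^sup>2 * Q0\<^sup>2"
        using False Q by (intro mult_mono power_mono) auto
      also have "\<dots> = 1" using Q0pos by simp
      finally show ?thesis using one[OF Q] by linarith
    qed
  qed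
qed

section \<open>Discrepancy\<close>

text \<open>As \<open>P\<close> vanishes at 0, \<open>a\<close> divides the value of
  \<open>P\<close> at \<open>a\<close>, so a denominator coprime to that value is coprime to
  \<open>a\<close>. The fractions are thus reduced, distinct pairs give distinct points, and points
  can be counted denominator by denominator.\<close>

lemma card_poly_farey_le:
  fixes \<alpha> :: real
  assumes P0: "poly P 0 = 0" and \<alpha>: "0 \<le> \<alpha>" "\<alpha> \<le> 1"
  shows "real (card {x\<in>poly_farey P Q. x \<le> \<alpha>}) =
    (\<Sum>q=1..int Q. real (card {a\<in>{1..\<lfloor>\<alpha> * q\<rfloor>}. coprime (poly P a) q}))"
proof -
  define W where "W = (SIGMA q:{1..int Q}. {a\<in>{1..\<lfloor>\<alpha> * q\<rfloor>}. coprime (poly P a) q})"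
  define f where "f = (\<lambda>(q, a). real_of_int a / real_of_int q)"
  have inj: "inj_on f W"
  proof (rule inj_onI)
    fix s t assume st: "s \<in> W" "t \<in> W" "f s = f t"
    obtain q a q' a' where s: "s = (q, a)" and t: "t = (q', a')" by force
    have pos: "1 \<le> q" "1 \<le> a" "1 \<le> q'" "1 \<le> a'" and c: "coprime (poly P a) q" "coprime (poly P a') q'"
      using st(1,2) by (auto simp: s t W_def)
    have "real_of_int (a * q') = real_of_int (a' * q)"
      using st(3) pos by (simp add: f_def s t field_simps)
    then have eq: "a * q' = a' * q" by (simp only: of_int_eq_iff)
    have "x dvd poly P x" for x using diff_dvd_poly_diff[of x 0 P] P0 by simp
    then have "coprime a q" "coprime a' q'"
      using coprime_divisors[OF _ dvd_refl c(1)] coprime_divisors[OF _ dvd_refl c(2)] by blast+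
    moreover have "q dvd a * q'" "q' dvd a' * q" using eq by (simp, simp flip: eq)
    ultimately have "q dvd q'" "q' dvd q"
      by (simp_all add: coprime_dvd_mult_right_iff coprime_commute)
    then have "q = q'" using pos by (simp add: zdvd_antisym_nonneg)
    with eq pos show "s = t" by (simp add: s t)
  qed
  have img: "f ` W = {x\<in>poly_farey P Q. x \<le> \<alpha>}"
  proof (rule subset_antisym)
    show "f ` W \<subseteq> {x\<in>poly_farey P Q. x \<le> \<alpha>}"
    proof (rule image_subsetI)
      fix s assume "s \<in> W"
      moreover obtain q a where s: "s = (q, a)" by force
      ultimately have q: "1 \<le> q" "q \<le> int Q" and a: "1 \<le> a" "a \<le> \<lfloor>\<alpha> * q\<rfloor>" and c: "coprime (poly P a) q"
        by (auto simp: W_def)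
      have le: "real_of_int a \<le> \<alpha> * real_of_int q" using a(2) by (simp add: le_floor_iff)
      also have "\<dots> \<le> real_of_int q" using \<alpha> q by (simp add: mult_left_le_one_le)
      finally have "a \<le> q" by simp
      moreover have "gcd (poly P a) q = 1" using c by (simp only: coprime_iff_gcd_eq_1)
      ultimately have "f s \<in> poly_farey P Q" unfolding poly_farey_def s f_def
        using q a(1) by (intro CollectI exI[of _ "nat a"] exI[of _ "nat q"]) (simp add: nat_le_iff nat_mono)
      moreover have "f s \<le> \<alpha>" using le q by (simp add: f_def s field_simps)
      ultimately show "f s \<in> {x\<in>poly_farey P Q. x \<le> \<alpha>}" by blast
    qed
    show "{x\<in>poly_farey P Q. x \<le> \<alpha>} \<subseteq> f ` W"
    proof
      fix x assume x: "x \<in> {x\<in>poly_farey P Q. x \<le> \<alpha>}"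
      then obtain a q where aq: "x = real a / real q" "1 \<le> a" "a \<le> q" "q \<le> Q" "gcd (poly P (int a)) (int q) = 1"
        by (auto simp: poly_farey_def)
      have "real a \<le> \<alpha> * real q" using x aq by (simp add: field_simps)
      then have "int a \<le> \<lfloor>\<alpha> * real_of_int (int q)\<rfloor>" by (simp add: le_floor_iff)
      then have "(int q, int a) \<in> W" using aq by (auto simp: W_def coprime_iff_gcd_eq_1)
      moreover have "x = f (int q, int a)" using aq by (simp add: f_def)
      ultimately show "x \<in> f ` W" by blast
    qed
  qed
  have "card {x\<in>poly_farey P Q. x \<le> \<alpha>} = card W"
    unfolding img[symmetric] by (rule card_image[OF inj])
  also have "\<dots> = (\<Sum>q=1..int Q. card {a\<in>{1..\<lfloor>\<alpha> * q\<rfloor>}. coprime (poly P a) q})"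
    unfolding W_def by (intro card_SigmaI ballI finite_Collect_conjI disjI1) auto
  finally show ?thesis by simp
qed

lemma card_poly_farey:
  assumes "poly P 0 = 0"
  shows "real (card (poly_farey P Q)) = (\<Sum>q=1..int Q. real (card {a\<in>{1..q}. coprime (poly P a) q}))"
proof -
  have "x \<le> 1" if "x \<in> poly_farey P Q" for x using that by (auto simp: poly_farey_def)
  then have "poly_farey P Q = {x\<in>poly_farey P Q. x \<le> 1}" by auto
  with card_poly_farey_le[OF assms, of 1 Q] show ?thesis by simp
qed

lemma finite_poly_farey: "finite (poly_farey P Q)"
proof (rule finite_subset)
  show "poly_farey P Q \<subseteq> (\<lambda>(a, q). real a / real q) ` ({..Q} \<times> {..Q})"
    by (force simp: poly_farey_def)
qed simp

text \<open>A real supremum bounds its members only over a bounded range; here the quotient and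
  \<alpha> both lie between 0 and 1. For empty \<open>S\<close> the quotient is 0, as division by 0
  gives 0.\<close>

lemma discrepancy_ge:
  assumes "finite S" "0 \<le> \<alpha>" "\<alpha> \<le> 1"
  shows "\<bar>real (card {x \<in> S. x \<le> \<alpha>}) / real (card S) - \<alpha>\<bar> \<le> discrepancy S"
  unfolding discrepancy_def
proof (rule cSUP_upper)
  show "bdd_above ((\<lambda>\<alpha>. \<bar>real (card {x \<in> S. x \<le> \<alpha>}) / real (card S) - \<alpha>\<bar>) ` {0..1})"
  proof (rule bdd_aboveI2)
    fix \<beta> :: real assume \<beta>: "\<beta> \<in> {0..1}"
    have "card {x \<in> S. x \<le> \<beta>} \<le> card S" using assms(1) by (intro card_mono) auto
    then have "real (card {x \<in> S. x \<le> \<beta>}) / real (card S) \<le> 1"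
      by (cases "card S = 0") (auto simp: divide_le_eq_1)
    moreover have "0 \<le> real (card {x \<in> S. x \<le> \<beta>}) / real (card S)" by simp
    ultimately show "\<bar>real (card {x \<in> S. x \<le> \<beta>}) / real (card S) - \<beta>\<bar> \<le> 1"
      using \<beta> unfolding atLeastAtMost_iff by linarith
  qed
qed (use assms in auto)

text \<open>Evaluated at \<open>1 / (2 * Q)\<close>, strictly below the least possible point
  \<open>1 / Q\<close>: the count there is 0 and the deviation is \<open>1 / (2 * Q)\<close>
  itself.\<close>

lemma discrepancy_poly_farey_ge:
  assumes "1 \<le> Q"
  shows "1 / 2 * (1 / real Q) \<le> discrepancy (poly_farey P Q)"
proof -
  have "\<not> x \<le> 1 / (2 * real Q)" if x: "x \<in> poly_farey P Q" for x
  proof -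
    obtain a q where aq: "x = real a / real q" "1 \<le> a" "a \<le> q" "q \<le> Q" using x by (auto simp: poly_farey_def)
    have "1 / (2 * real Q) < 1 / real Q" using assms by (simp add: field_simps)
    also have "\<dots> \<le> real a / real q" using aq by (intro frac_le) auto
    finally show ?thesis using aq by simp
  qed
  then have none: "{x \<in> poly_farey P Q. x \<le> 1 / (2 * real Q)} = {}" by auto
  have "1 / (2 * real Q) \<le> 1" using assms by (simp add: field_simps)
  then show ?thesis
    using discrepancy_ge[OF finite_poly_farey, of "1 / (2 * real Q)" P Q] unfolding none by simp
qed

text \<open>The upper bound starts at \<open>Q = 2\<close>. For \<open>Q = 1\<close> the only point
  is 1, with discrepancy 1, whereas \<open>ln 1 ^ J = 0\<close> because the factor \<open>x\<close>
  of \<open>P\<close> makes \<open>J\<close> positive.\<close>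

theorem theorem1p1:
  fixes \<nu> J :: nat and c :: "nat \<Rightarrow> int" and P :: "int poly"
  assumes "\<nu> \<ge> 2"
    and "\<exists>i\<in>{1..\<nu>}. c i \<noteq> 0"
    and "P = (\<Sum>i=1..\<nu>. monom (c i) i)"
    and "discriminant P \<noteq> 0"
    and "J = num_irreducible_factors P"
  shows "\<exists>C\<^sub>1 > 0. \<exists>C\<^sub>2 > 0.
           (\<forall>Q::nat. Q \<ge> 1 \<longrightarrow> C\<^sub>1 * (1 / real Q) \<le> discrepancy (poly_farey P Q)) \<and>
           (\<forall>Q::nat. Q \<ge> 2 \<longrightarrow> discrepancy (poly_farey P Q) \<le> C\<^sub>2 * (ln (real Q) ^ J / real Q))"
proof -
  have "coeff P i = (if i \<in> {1..\<nu>} then c i else 0)" for i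
    unfolding assms(3) coeff_sum by (simp add: sum.delta)
  then have "P \<noteq> 0" using assms(2) by (metis coeff_0)
  have P0: "poly P 0 = 0" by (simp add: assms(3) poly_sum poly_monom zero_power)
  obtain C where C: "0 \<le> C" "\<And>Q::int. 2 \<le> Q \<Longrightarrow> root_sum P Q \<le> C * ln (real_of_int Q) ^ J"
    using root_sum_bound[OF \<open>P \<noteq> 0\<close>] assms(5) by blast
  obtain b where b: "0 < b" "\<And>Q::int. 1 \<le> Q \<Longrightarrow>
      b * (real_of_int Q)\<^sup>2 \<le> (\<Sum>q=1..Q. real (card {a\<in>{1..q}. coprime (poly P a) q}))"
    using coprime_pairs_lower_bound[OF \<open>P \<noteq> 0\<close>] by blast
  \<comment> \<open>\<open>b\<close> comes from the quadratic lower bound for the number of points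
    and \<open>C\<close> from the bound for \<open>root_sum\<close>; adding 1 keeps the constant
    positive when \<open>C = 0\<close>.\<close>
  have upper: "discrepancy (poly_farey P Q) \<le> (C + 1) / b * (ln (real Q) ^ J / real Q)" if Q: "2 \<le> Q" for Q :: nat
    unfolding discrepancy_def
  proof (rule cSUP_least)
    fix \<alpha> :: real assume \<alpha>: "\<alpha> \<in> {0..1}"
    let ?N = "real (card (poly_farey P Q))" and ?A = "real (card {x\<in>poly_farey P Q. x \<le> \<alpha>})"
    have N: "b * (real Q)\<^sup>2 \<le> ?N" using b(2)[of "int Q"] Q by (simp add: card_poly_farey[OF P0])
    have bQ: "0 < b * (real Q)\<^sup>2" using b(1) Q by simp
    have ln0: "0 \<le> ln (real Q) ^ J" using Q by simp
    have "\<bar>?A - \<alpha> * ?N\<bar> \<le> real Q * root_sum P (int Q)"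
      using total_discrepancy[of "int Q" \<alpha> P] \<alpha> Q
      by (simp add: card_poly_farey[OF P0] card_poly_farey_le[OF P0])
    also have "\<dots> \<le> real Q * ((C + 1) * ln (real Q) ^ J)"
    proof (rule mult_left_mono)
      have "root_sum P (int Q) \<le> C * ln (real Q) ^ J" using C(2)[of "int Q"] Q by simp
      also have "\<dots> \<le> (C + 1) * ln (real Q) ^ J" using ln0 by (intro mult_right_mono) auto
      finally show "root_sum P (int Q) \<le> (C + 1) * ln (real Q) ^ J" .
    qed simp
    finally have diff: "\<bar>?A - \<alpha> * ?N\<bar> \<le> real Q * ((C + 1) * ln (real Q) ^ J)" .
    have "\<bar>?A / ?N - \<alpha>\<bar> = \<bar>?A - \<alpha> * ?N\<bar> / ?N"
    proof -
      have "?A / ?N - \<alpha> = (?A - \<alpha> * ?N) / ?N" using N bQ by (simp add: field_simps)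
      then show ?thesis by (simp add: abs_divide)
    qed
    also have "\<dots> \<le> (real Q * ((C + 1) * ln (real Q) ^ J)) / (b * (real Q)\<^sup>2)"
      using diff N bQ by (intro frac_le) auto
    also have "\<dots> = (C + 1) / b * (ln (real Q) ^ J / real Q)"
      using Q b(1) by (simp add: field_simps power2_eq_square)
    finally show "\<bar>?A / ?N - \<alpha>\<bar> \<le> (C + 1) / b * (ln (real Q) ^ J / real Q)" .
  qed simp
  show ?thesis
    using discrepancy_poly_farey_ge[of _ P] upper C(1) b(1)
    by (intro exI[of _ "1 / 2 :: real"] conjI exI[of _ "(C + 1) / b"]) auto
qed

end
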